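(* Let $f:\mathbb{R}^2\to\mathbb{R}^2$ be an orientation preserving homeomorphism of class $C^1$ with symmetry group $D_2$. Suppose that $\mathrm{Fix}(f)=\{0\}$ and $0$ is a local direct saddle. Then $0$ is a global saddle for $f$. In addition, the global curves $W^s(0,f)$ and $W^u(0,f)$ divide the plane in four connected components (i.e. $\mathbb{R}^2\setminus(W^s(0,f)\cup W^u(0,f))$ has exactly four connected components) that are invariant by $f$.
   Context: "Homeomorphism of class $C^1$" means a homeomorphism of $\mathbb{R}^2$ that is a $C^1$ map (its inverse need not be $C^1$). $\mathrm{Fix}(f)$ is the set of fixed points of $f$. A symmetry of $f$ is a linear map $\gamma\in GL(2)$ with $f(\gamma x)=\gamma f(x)$ for all $x$; the symmetry group of $f$ is the (largest closed) subset of $GL(2)$ containing all symmetries of $f$. $D_2=\mathbb{Z}_2^a\oplus\mathbb{Z}_2^b$ is the group generated by two reflections $a$ and $b$ on orthogonal lines through the origin. For a $C^1$ map $f:\mathbb{R}^2\to\mathbb{R}^2$ with $f(0)=0$, $0$ is a local saddle if $Df(0)$ has real eigenvalues $\lambda,\mu$ with $0<|\lambda|<1<|\mu|$; it is a local direct saddle if moreover $\lambda,\mu>0$. Stable and unstable curves: for an invertible $f$, $W^s=W^s(0,f)=\{x\in\mathbb{R}^2:\lim_{n\to\infty}f^n(x)=0\}$ and $W^u=W^u(0,f)=W^s(0,f^{-1})$. Each of these is the image of a continuous injective curve $\tau:\mathbb{R}\to\mathbb{R}^2$ with $\tau(0)=0$; the images of $[0,+\infty)$ and $(-\infty,0]$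 are its two branches $\beta^+$, $\beta^-$. For continuous bijections $\zeta:[0,+\infty)\to\beta^+$, $\zeta':(-\infty,0]\to\beta^-$, put $\mathcal{L}(\beta^+)=\bigcap_{t\ge 0}\overline{\zeta([t,+\infty))}$ and $\mathcal{L}(\beta^-)=\bigcap_{t\le 0}\overline{\zeta'((-\infty,t])}$ (closures in $\mathbb{R}^2$; independent of the parametrisation). $\mathcal{L}(W^s)$ (resp. $\mathcal{L}(W^u)$) is the union of the limit sets of the two branches of $W^s$ (resp. $W^u$). A homoclinic contact is a point of $(W^u\cap W^s\setminus\{0\})\cup(\mathcal{L}(W^u)\cap\overline{W^s})\cup(\mathcal{L}(W^s)\cap\overline{W^u})$. Global saddle: for a homeomorphism $f$ of $\mathbb{R}^2$ of class $C^1$ with $f(0)=0$, $0$ is a global (topological) saddle if $0$ is a local saddle, there are no homoclinic contacts, $W^s(0,f)$ and $W^u(0,f)$ are unbounded sets, and for all $p\notin W^s(0,f)\cup W^u(0,f)\cup\{0\}$ both $\|f^n(p)\|\to\infty$ and $\|f^{-n}(p)\|\to\infty$ as $n\to\infty$. *)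

theory Defs
  imports "HOL-Analysis.Analysis" "HOL-Complex_Analysis.Complex_Analysis"
    "HOL-Algebra.Generated_Groups"
begin

definition C1_map :: "(real^2 \<Rightarrow> real^2) \<Rightarrow> bool" where
  "C1_map f \<longleftrightarrow>
    (\<exists>f' :: real^2 \<Rightarrow> ((real^2) \<Rightarrow>\<^sub>L (real^2)).
      (\<forall>x. (f has_derivative blinfun_apply (f' x)) (at x)) \<and> continuous_on UNIV f')"

(* The inverse is only required to be continuous.  It is written inv_into UNIV f because
   HOL-Algebra overloads the notation inv. *)
definition C1_homeomorphism :: "(real^2 \<Rightarrow> real^2) \<Rightarrow> bool" where
  "C1_homeomorphism f \<longleftrightarrow> homeomorphism UNIV UNIV f (inv_into UNIV f) \<and> C1_map f"

definition complex_of_vec :: "real^2 \<Rightarrow> complex" where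
  "complex_of_vec x = Complex (x $ 1) (x $ 2)"

definition vec_of_complex :: "complex \<Rightarrow> real^2" where
  "vec_of_complex z = vector [Re z, Im z]"

(* A planar homeomorphism preserves orientation if it has local degree 1: it sends every
   positively oriented circle to a loop that winds once, positively, around the image of the
   centre. *)
definition orientation_preserving :: "(real^2 \<Rightarrow> real^2) \<Rightarrow> bool" where
  "orientation_preserving f \<longleftrightarrow>
    (\<forall>p r. r > 0 \<longrightarrow>
      winding_number (complex_of_vec \<circ> f \<circ> vec_of_complex \<circ> circlepath (complex_of_vec p) r)
        (complex_of_vec (f p)) = 1)"

definition Fix :: "(real^2 \<Rightarrow> real^2) \<Rightarrow> (real^2) set" where
  "Fix f = {x. f x = x}"

definition GL2 :: "(real^2^2) monoid" where
  "GL2 = \<lparr>carrier = {A. invertible A}, mult = (**), one = mat 1\<rparr>"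

(* The set of all symmetries is automatically closed in GL(2) when f is continuous, so no
   closure has to be taken. *)
definition symmetry_group :: "(real^2 \<Rightarrow> real^2) \<Rightarrow> (real^2^2) set" where
  "symmetry_group f = {A \<in> carrier GL2. \<forall>x. f (A *v x) = A *v f x}"

(* The orthogonal reflection that fixes the line spanned by the nonzero vector u. *)
definition line_reflection :: "real^2 \<Rightarrow> real^2^2" where
  "line_reflection u = matrix (\<lambda>x. (2 * (u \<bullet> x) / (u \<bullet> u)) *\<^sub>R u - x)"

definition is_D2 :: "(real^2^2) set \<Rightarrow> bool" where
  "is_D2 G \<longleftrightarrow>
    (\<exists>u v. u \<noteq> 0 \<and> v \<noteq> 0 \<and> u \<bullet> v = 0 \<and>
      G = generate GL2 {line_reflection u, line_reflection v})"

definition is_eigenvalue :: "(real^2 \<Rightarrow> real^2) \<Rightarrow> real \<Rightarrow> bool" where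
  "is_eigenvalue L l \<longleftrightarrow> (\<exists>v. v \<noteq> 0 \<and> L v = l *\<^sub>R v)"

definition local_saddle :: "(real^2 \<Rightarrow> real^2) \<Rightarrow> bool" where
  "local_saddle f \<longleftrightarrow> C1_map f \<and> f 0 = 0 \<and>
    (\<exists>l m. is_eigenvalue (frechet_derivative f (at 0)) l \<and>
           is_eigenvalue (frechet_derivative f (at 0)) m \<and>
           0 < \<bar>l\<bar> \<and> \<bar>l\<bar> < 1 \<and> 1 < \<bar>m\<bar>)"

definition local_direct_saddle :: "(real^2 \<Rightarrow> real^2) \<Rightarrow> bool" where
  "local_direct_saddle f \<longleftrightarrow> C1_map f \<and> f 0 = 0 \<and>
    (\<exists>l m. is_eigenvalue (frechet_derivative f (at 0)) l \<and>
           is_eigenvalue (frechet_derivative f (at 0)) m \<and>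
           0 < \<bar>l\<bar> \<and> \<bar>l\<bar> < 1 \<and> 1 < \<bar>m\<bar> \<and> 0 < l \<and> 0 < m)"

definition Ws :: "(real^2 \<Rightarrow> real^2) \<Rightarrow> (real^2) set" where
  "Ws f = {x. (\<lambda>n. (f ^^ n) x) \<longlonglongrightarrow> 0}"

definition Wu :: "(real^2 \<Rightarrow> real^2) \<Rightarrow> (real^2) set" where
  "Wu f = Ws (inv_into UNIV f)"

definition curve_param :: "(real \<Rightarrow> real^2) \<Rightarrow> (real^2) set \<Rightarrow> bool" where
  "curve_param \<tau> W \<longleftrightarrow> continuous_on UNIV \<tau> \<and> inj \<tau> \<and> \<tau> 0 = 0 \<and> range \<tau> = W"

(* The branches are the images under tau of the half-lines [0,oo) and (-oo,0]; the restrictions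
   of tau to these half-lines parametrise them. *)
definition branch_limit_pos :: "(real \<Rightarrow> real^2) \<Rightarrow> (real^2) set" where
  "branch_limit_pos \<tau> = (\<Inter>t\<in>{0..}. closure (\<tau> ` {t..}))"

definition branch_limit_neg :: "(real \<Rightarrow> real^2) \<Rightarrow> (real^2) set" where
  "branch_limit_neg \<tau> = (\<Inter>t\<in>{..0}. closure (\<tau> ` {..t}))"

(* The limit sets do not depend on the parametrisation; the union over all parametrisations
   is their common value and avoids an arbitrary choice.  It is meaningful only if W has a
   parametrisation, which global_saddle therefore demands explicitly. *)
definition curve_limit_set :: "(real^2) set \<Rightarrow> (real^2) set" where
  "curve_limit_set W = (\<Union>\<tau>\<in>{\<tau>. curve_param \<tau> W}. branch_limit_pos \<tau> \<union> branch_limit_neg \<tau>)"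

definition homoclinic_contacts :: "(real^2 \<Rightarrow> real^2) \<Rightarrow> (real^2) set" where
  "homoclinic_contacts f =
     (Wu f \<inter> Ws f - {0}) \<union>
     (curve_limit_set (Wu f) \<inter> closure (Ws f)) \<union>
     (curve_limit_set (Ws f) \<inter> closure (Wu f))"

definition global_saddle :: "(real^2 \<Rightarrow> real^2) \<Rightarrow> bool" where
  "global_saddle f \<longleftrightarrow>
     C1_homeomorphism f \<and> f 0 = 0 \<and>
     local_saddle f \<and>
     (\<exists>\<tau>. curve_param \<tau> (Ws f)) \<and> (\<exists>\<tau>. curve_param \<tau> (Wu f)) \<and>
     homoclinic_contacts f = {} \<and>
     \<not> bounded (Ws f) \<and> \<not> bounded (Wu f) \<and>
     (\<forall>p. p \<notin> Ws f \<union> Wu f \<union> {0} \<longrightarrow>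
        filterlim (\<lambda>n. norm ((f ^^ n) p)) at_top sequentially \<and>
        filterlim (\<lambda>n. norm ((inv_into UNIV f ^^ n) p)) at_top sequentially)"

end

theory Submission
  imports Defs
begin

text \<open>
  Since \<open>f\<close> commutes with the two reflections, it preserves both axes, and its derivative at \<open>0\<close>
  is diagonal. Having no other fixed point, \<open>f\<close> contracts one axis to \<open>0\<close> and expands the other,
  and it maps every open quadrant to itself. A quadrant is a plane on which \<open>f\<close> has no fixed point,
  so by Brouwer's lemma no orbit returns to a free connected open set. Applied to the traces on the
  quadrant of small discs around points \<open>q \<noteq> 0\<close> of its closure, this shows that an orbit in the
  quadrant can accumulate only at \<open>0\<close>; it then either tends to infinity or converges to \<open>0\<close>, and the
  latter is excluded by the expansion along the second axis near \<open>0\<close>. So the stable and unstable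
  curves are exactly the axes.

  Brouwer's lemma is reduced to orbits of period two by pushing points along free arcs (after Fathi).
  Orbits of period two are excluded by comparing the rotation of \<open>h z - z\<close> with the rotation of
  pairs of points, which is a well-defined continuous function because
  \<open>t \<mapsto> f (t z) / t\<close> is an isotopy from \<open>f\<close> to its derivative at \<open>0\<close>.
\<close>

section \<open>Rotation of pairs of points\<close>

definition pair_space :: "(complex \<times> complex) set" where
  "pair_space = {p. fst p \<noteq> snd p}"

text \<open>
  Among planar homeomorphisms this characterises those that preserve orientation: the rotation
  angle of the vector from one point to another under the map is a continuous function of the
  unordered pair of points.
\<close>
definition has_pair_log :: "(complex \<Rightarrow> complex) \<Rightarrow> bool" where
  "has_pair_log h \<longleftrightarrow> (\<exists>g. continuous_on pair_space g \<and>
     (\<forall>a b. a \<noteq> b \<longrightarrow> h a - h b = (a - b) * exp (g (a, b)) \<and> g (a, b) = g (b, a)))"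

text \<open>In the coordinates base point and difference this is the product of the plane and the
  punctured plane.\<close>

lemma connected_pair_space: "connected pair_space"
proof -
  have "pair_space = (\<lambda>(c, d). (c + d, c)) ` (UNIV \<times> (- {0}))"
  proof (intro equalityI subsetI)
    fix p :: "complex \<times> complex" assume "p \<in> pair_space"
    then show "p \<in> (\<lambda>(c, d). (c + d, c)) ` (UNIV \<times> (- {0}))"
      by (intro image_eqI[where x = "(snd p, fst p - snd p)"]) (auto simp: pair_space_def)
  qed (auto simp: pair_space_def)
  moreover have "connected (- {0 :: complex})"
    by (rule connected_punctured_universe) simp
  then have "connected ((\<lambda>(c :: complex, d). (c + d, c)) ` (UNIV \<times> (- {0})))"
    by (intro connected_continuous_image connected_Times)
       (auto intro!: continuous_intros simp: case_prod_unfold connected_UNIV)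
  ultimately show ?thesis by simp
qed

text \<open>The values lie in 2 pi i Z and so are uniformly separated; a continuous function cannot
  jump between them on a connected set.\<close>

lemma exp_one_constant:
  fixes c :: "'a::topological_space \<Rightarrow> complex"
  assumes "connected S" "continuous_on S c" and one: "\<And>x. x \<in> S \<Longrightarrow> exp (c x) = 1"
  obtains k where "\<And>x. x \<in> S \<Longrightarrow> c x = k"
proof -
  have "\<exists>e>0. \<forall>y. y \<in> S \<and> c y \<noteq> c x \<longrightarrow> e \<le> norm (c y - c x)" if x: "x \<in> S" for x
  proof (intro exI[of _ "1::real"] conjI allI impI)
    fix y assume y: "y \<in> S \<and> c y \<noteq> c x"
    obtain m n :: int where mn: "Re (c x) = 0" "Im (c x) = of_int (2 * m) * pi"
        "Re (c y) = 0" "Im (c y) = of_int (2 * n) * pi"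
      using one[of x] one[of y] x y exp_eq_1 by metis
    then have "m \<noteq> n" using y by (auto simp: complex_eq_iff)
    then have "1 \<le> \<bar>real_of_int (n - m)\<bar>" by linarith
    moreover have "Im (c y - c x) = 2 * pi * real_of_int (n - m)"
      using mn by (simp add: algebra_simps)
    ultimately have "1 \<le> \<bar>Im (c y - c x)\<bar>"
      using pi_gt3 by (simp add: abs_mult) (smt (verit) mult_le_cancel_left1)
    then show "1 \<le> norm (c y - c x)" using abs_Im_le_cmod order_trans by blast
  qed simp
  then have "c constant_on S"
    using continuous_discrete_range_constant[OF assms(1,2)] by blast
  then show ?thesis using that by (auto simp: constant_on_def)
qed

text \<open>Symmetry comes for free: \<open>g (a, b) - g (b, a)\<close> is constant on the connected
  pair space, and swapping the points negates it.\<close>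

lemma has_pair_logI:
  assumes g: "continuous_on pair_space g"
    and eq: "\<And>a b. a \<noteq> b \<Longrightarrow> h a - h b = (a - b) * exp (g (a, b))"
  shows "has_pair_log h"
proof -
  let ?c = "\<lambda>p. g p - g (snd p, fst p)"
  have swap: "continuous_on pair_space (\<lambda>p. g (snd p, fst p))"
    by (rule continuous_on_compose2[OF g]) (auto simp: pair_space_def intro!: continuous_intros)
  have "exp (?c p) = 1" if p: "p \<in> pair_space" for p
  proof -
    obtain a b where ab: "p = (a, b)" "a \<noteq> b" using p by (cases p) (auto simp: pair_space_def)
    have "(a - b) * exp (g (a, b)) = (a - b) * exp (g (b, a))"
      using eq[of a b] eq[of b a] ab(2) by (metis minus_diff_eq minus_mult_left)
    then show ?thesis using ab by (simp add: exp_diff)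
  qed
  then obtain k where k: "\<And>p. p \<in> pair_space \<Longrightarrow> ?c p = k"
    using exp_one_constant[OF connected_pair_space continuous_on_diff[OF g swap]] by blast
  have "g (a, b) = g (b, a)" if "a \<noteq> b" for a b
  proof -
    have "g (a, b) - g (b, a) = g (b, a) - g (a, b)"
      using k[of "(a, b)"] k[of "(b, a)"] that by (simp add: pair_space_def)
    then have "2 * (g (a, b) - g (b, a)) = 0" by (simp add: algebra_simps)
    then show ?thesis by simp
  qed
  then show ?thesis using g eq unfolding has_pair_log_def by blast
qed

text \<open>Logarithms of difference quotients add under composition.\<close>

lemma has_pair_log_compose:
  assumes "has_pair_log h" "has_pair_log k" "continuous_on UNIV k" "inj k"
  shows "has_pair_log (h \<circ> k)"
proof -
  obtain g where g: "continuous_on pair_space g"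
      "\<And>a b. a \<noteq> b \<Longrightarrow> h a - h b = (a - b) * exp (g (a, b))"
    using assms(1) unfolding has_pair_log_def by blast
  obtain g' where g': "continuous_on pair_space g'"
      "\<And>a b. a \<noteq> b \<Longrightarrow> k a - k b = (a - b) * exp (g' (a, b))"
    using assms(2) unfolding has_pair_log_def by blast
  have kab: "k a \<noteq> k b" if "a \<noteq> b" for a b using assms(4) that by (simp add: inj_eq)
  have "continuous_on pair_space (\<lambda>p. (k (fst p), k (snd p)))"
    by (intro continuous_intros continuous_on_compose2[OF assms(3)]) auto
  then have "continuous_on pair_space (\<lambda>p. g (k (fst p), k (snd p)))"
    by (rule continuous_on_compose2[OF g(1)]) (use kab in \<open>auto simp: pair_space_def\<close>)
  then have "continuous_on pair_space (\<lambda>p. g (k (fst p), k (snd p)) + g' p)"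
    using g'(1) by (rule continuous_on_add)
  moreover have "(h \<circ> k) a - (h \<circ> k) b
      = (a - b) * exp (g (k (fst (a, b)), k (snd (a, b))) + g' (a, b))" if "a \<noteq> b" for a b
    using g(2)[OF kab[OF that]] g'(2)[OF that] by (simp only: o_apply fst_conv snd_conv exp_add mult_ac)
  ultimately show ?thesis by (rule has_pair_logI)
qed

text \<open>
  The isotopy \<open>t \<mapsto> (h (c + t z) - h c) / t\<close> joins the translate of \<open>h\<close> to its derivative at \<open>c\<close>.
\<close>
lemma has_pair_log_derivative:
  assumes cont: "continuous_on UNIV h" and inj: "inj h"
    and der: "(h has_derivative L) (at c)"
    and pos: "\<And>v. v \<noteq> 0 \<Longrightarrow> 0 < Re (L v / v)"
  shows "has_pair_log h"
proof -
  interpret L: bounded_linear L using der by (rule has_derivative_bounded_linear)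
  \<comment> \<open>The normalised remainder of the first-order expansion. Division by zero gives
    \<open>e 0 = 0\<close>, exactly the value that makes \<open>e\<close> continuous.\<close>
  define e where "e w = (h (c + w) - h c - L w) /\<^sub>R norm w" for w
  have contL: "continuous_on A L" for A by (simp add: L.continuous_on)
  have "isCont e w" for w
  proof (cases "w = 0")
    case True
    have "(\<lambda>w. norm (h (c + w) - h c - L w) / norm w) \<midarrow>0\<rightarrow> 0"
      using der unfolding has_derivative_at by blast
    then have "(\<lambda>w. norm (e w)) \<midarrow>0\<rightarrow> 0"
      by (simp add: e_def divide_inverse mult.commute)
    then have "e \<midarrow>0\<rightarrow> 0" by (rule tendsto_norm_zero_cancel)
    moreover have "e 0 = 0" by (simp add: e_def)
    ultimately show ?thesis using True by (simp add: isCont_def)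
  next
    case False
    have "continuous_on UNIV (\<lambda>w. h (c + w))"
      by (rule continuous_on_compose2[OF cont]) (auto intro!: continuous_intros)
    then have "isCont (\<lambda>w. h (c + w)) w" by (simp add: continuous_on_eq_continuous_at)
    moreover have "isCont L w" using contL[of UNIV] by (simp add: continuous_on_eq_continuous_at)
    ultimately show ?thesis unfolding e_def using False
      by (auto intro!: continuous_intros)
  qed
  then have conte: "continuous_on UNIV e" by (simp add: continuous_at_imp_continuous_on)
  \<comment> \<open>The isotopy written without division by \<open>t\<close>, so that joint
    continuity includes \<open>t = 0\<close>.\<close>
  define H where "H t z = L z + norm z *\<^sub>R e (t *\<^sub>R z)" for t z
  have H_pos: "H t z = (h (c + t *\<^sub>R z) - h c) /\<^sub>R t" if "0 < t" for t z
    using that by (cases "z = 0") (simp_all add: H_def e_def L.scaleR field_simps scaleR_diff_right L.zero)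
  have H_0: "H 0 z = L z" for z by (simp add: H_def e_def L.zero)
  have L_neq: "L v \<noteq> 0" if "v \<noteq> 0" for v using pos[OF that] by auto
  have H_inj: "H t a \<noteq> H t b" if "a \<noteq> b" "0 \<le> t" for t a b
  proof (cases "t = 0")
    case True
    then show ?thesis using L_neq[of "a - b"] that by (simp add: H_0 L.diff)
  next
    case False
    then show ?thesis using that inj by (simp add: H_pos inj_eq)
  qed
  define R where "R t p = (H t (fst p) - H t (snd p)) / (fst p - snd p)" for t p
  have contH: "continuous_on A (\<lambda>q. H (fst q) (k q))" if "continuous_on A k"
    for A and k :: "real \<times> complex \<times> complex \<Rightarrow> complex"
    unfolding H_def
    by (intro continuous_intros continuous_on_compose2[OF contL[of UNIV]]
        continuous_on_compose2[OF conte] that) auto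
  have "continuous_on ({0..1} \<times> pair_space) (\<lambda>q. R (fst q) (snd q))"
    unfolding R_def by (intro continuous_intros contH) (auto simp: pair_space_def)
  moreover have "R t p \<noteq> 0" if "0 \<le> t" "p \<in> pair_space" for t p
    using that H_inj by (auto simp: R_def pair_space_def)
  ultimately have hom: "homotopic_with_canon (\<lambda>h. True) pair_space (- {0}) (R 0) (R 1)"
    unfolding homotopic_with_def
    by (intro exI[of _ "\<lambda>q. R (fst q) (snd q)"]) auto
  \<comment> \<open>The hypothesis on \<open>L\<close> puts the values of \<open>R 0\<close> in the
    right half-plane, where the principal logarithm is continuous.\<close>
  have "continuous_on pair_space (\<lambda>p. Ln (R 0 p)) \<and> (\<forall>p\<in>pair_space. R 0 p = exp (Ln (R 0 p)))"
  proof -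
    have R0: "R 0 p = L (fst p - snd p) / (fst p - snd p)" for p by (simp add: R_def H_0 L.diff)
    have Re_pos: "0 < Re (R 0 p)" if "p \<in> pair_space" for p
      using that pos[of "fst p - snd p"] by (simp add: R0 pair_space_def)
    have contR0: "continuous_on pair_space (R 0)"
      unfolding R0 by (intro continuous_intros continuous_on_compose2[OF contL[of UNIV]])
        (auto simp: pair_space_def)
    have "R 0 p \<notin> \<real>\<^sub>\<le>\<^sub>0 \<and> R 0 p \<noteq> 0" if "p \<in> pair_space" for p
      using Re_pos[OF that] by (auto simp: complex_nonpos_Reals_iff)
    then show ?thesis using contR0 by (auto intro!: continuous_on_Ln')
  qed
  \<comment> \<open>A continuous logarithm exists exactly when the map into the punctured plane is
    null-homotopic, and this passes from \<open>R 0\<close> to \<open>R 1\<close> along the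
    homotopy.\<close>
  then obtain a where "homotopic_with_canon (\<lambda>h. True) pair_space (- {0}) (R 0) (\<lambda>t. a)"
    using inessential_eq_continuous_logarithm[of pair_space "R 0"] by blast
  then have "homotopic_with_canon (\<lambda>h. True) pair_space (- {0}) (R 1) (\<lambda>t. a)"
    using hom homotopic_with_symD homotopic_with_trans by blast
  then obtain g where g: "continuous_on pair_space g" "\<And>p. p \<in> pair_space \<Longrightarrow> R 1 p = exp (g p)"
    using inessential_eq_continuous_logarithm[of pair_space "R 1"] by blast
  show ?thesis
  proof (rule has_pair_logI)
    show "continuous_on pair_space (\<lambda>p. g (fst p - c, snd p - c))"
      by (rule continuous_on_compose2[OF g(1)]) (auto simp: pair_space_def intro!: continuous_intros)
    fix a b :: complex assume "a \<noteq> b"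
    then show "h a - h b = (a - b) * exp (g (fst (a, b) - c, snd (a, b) - c))"
      using g(2)[of "(a - c, b - c)"] by (auto simp: pair_space_def R_def H_pos field_simps)
  qed
qed

text \<open>
  With \<open>T\<close> a logarithm of \<open>h z - z\<close> and \<open>g\<close> the logarithm of pairs,
  \<open>T (h z) - T z - g (h z, z)\<close> is a constant in \<open>2 \<pi> \<i> \<int>\<close>. Summing over an orbit of
  period two determines \<open>g\<close> there and contradicts that \<open>h\<close> swaps the two points.
\<close>
lemma no_period_two:
  assumes Q: "convex Q" and "continuous_on Q h" "h ` Q \<subseteq> Q"
    and nofix: "\<And>z. z \<in> Q \<Longrightarrow> h z \<noteq> z" and "has_pair_log h"
    and x: "x \<in> Q" "h (h x) = x"
  shows False
proof -
  obtain g where g: "continuous_on pair_space g"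
      "\<And>a b. a \<noteq> b \<Longrightarrow> h a - h b = (a - b) * exp (g (a, b))"
      "\<And>a b. a \<noteq> b \<Longrightarrow> g (a, b) = g (b, a)"
    using \<open>has_pair_log h\<close> unfolding has_pair_log_def by blast
  have hQ: "h z \<in> Q" if "z \<in> Q" for z using assms(3) that by blast
  obtain T where T: "continuous_on Q T" "\<And>z. z \<in> Q \<Longrightarrow> h z - z = exp (T z)"
  proof (rule continuous_logarithm_on_contractible[of Q "\<lambda>z. h z - z"])
    show "contractible Q" using Q by (rule convex_imp_contractible)
  qed (use nofix assms(2) in \<open>auto intro!: continuous_intros\<close>)
  define c where "c z = T (h z) - T z - g (h z, z)" for z
  have "continuous_on Q c"
    unfolding c_def using nofix hQ
    by (intro continuous_intros T continuous_on_compose2[OF T(1)] continuous_on_compose2[OF g(1)]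
        assms(2)) (auto simp: pair_space_def)
  moreover have "exp (c z) = 1" if "z \<in> Q" for z
  proof -
    have "exp (T (h z)) = exp (T z) * exp (g (h z, z))"
      using T(2)[of z] T(2)[of "h z"] g(2)[of "h z" z] that hQ nofix by auto
    then show ?thesis by (simp add: c_def exp_diff)
  qed
  ultimately obtain k where k: "\<And>z. z \<in> Q \<Longrightarrow> c z = k"
    using exp_one_constant convex_connected[OF Q] by blast
  have neq: "h x \<noteq> x" using nofix x by blast
  have "c x + c (h x) = - 2 * g (h x, x)"
    using g(3)[OF neq] by (simp add: c_def x)
  moreover have "c (h x) = c x" using k x(1) hQ by metis
  ultimately have "g (h x, x) = - c x" by simp
  moreover have "exp (c x) = 1" using \<open>\<And>z. z \<in> Q \<Longrightarrow> exp (c z) = 1\<close> x by blast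
  ultimately have "exp (g (h x, x)) = 1" by (simp add: exp_minus)
  then have "x - h x = h x - x" using g(2)[OF neq] x by simp
  then have "2 * (h x - x) = 0" by (simp add: algebra_simps)
  then show False using neq by simp
qed

section \<open>Brouwer's lemma in a quadrant\<close>

text \<open>In Brouwer's argument below the open convex set \<open>Q\<close> plays the role of the plane.\<close>
definition free_homeo :: "complex set \<Rightarrow> (complex \<Rightarrow> complex) \<Rightarrow> bool" where
  "free_homeo Q h \<longleftrightarrow> (\<exists>k. homeomorphism UNIV UNIV h k) \<and> h ` Q = Q \<and>
     (\<forall>z\<in>Q. h z \<noteq> z) \<and> has_pair_log h"

lemma free_homeo_simps:
  assumes "free_homeo Q h"
  shows "continuous_on A h" "inj h" "h ` Q = Q" "z \<in> Q \<Longrightarrow> h z \<in> Q" "z \<in> Q \<Longrightarrow> h z \<noteq> z"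
    "has_pair_log h"
proof -
  obtain k where k: "homeomorphism UNIV UNIV h k" using assms by (auto simp: free_homeo_def)
  show "continuous_on A h" using k continuous_on_subset by (auto simp: homeomorphism_def)
  show "inj h" using k by (metis UNIV_I homeomorphism_apply1 injI)
qed (use assms in \<open>auto simp: free_homeo_def\<close>)

lemma free_homeo_funpow_in:
  assumes "free_homeo Q h" "z \<in> Q"
  shows "(h ^^ n) z \<in> Q"
  by (induction n) (simp_all add: assms free_homeo_simps(4)[OF assms(1)])

text \<open>The map is the identity near \<open>c\<close>, so its derivative there is the identity
  and yields the pair logarithm.\<close>

lemma pushing_homeomorphism:
  fixes a b :: complex
  assumes U: "open U" "connected U" and ab: "a \<in> U" "b \<in> U" and c: "c \<notin> closure U"
  obtains \<phi> \<psi> where "homeomorphism UNIV UNIV \<phi> \<psi>" "\<phi> a = b" "\<And>z. z \<notin> U \<Longrightarrow> \<phi> z = z"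
    "\<phi> ` U = U" "has_pair_log \<phi>"
proof -
  have hull: "affine hull U = UNIV" using U ab affine_hull_open by blast
  obtain \<phi> \<psi> where h: "homeomorphism UNIV UNIV \<phi> \<psi>" "\<phi> a = b"
      and supp: "{x. \<not> (\<phi> x = x \<and> \<psi> x = x)} \<subseteq> U"
    by (rule homeomorphism_moving_point[of U UNIV a b]) (use U ab hull in auto)
  have out: "\<phi> z = z" "\<psi> z = z" if "z \<notin> U" for z using supp that by auto
  have inv: "\<phi> (\<psi> z) = z" "\<psi> (\<phi> z) = z" for z using h by (auto simp: homeomorphism_def)
  have "\<phi> z \<in> U" "\<psi> z \<in> U" if "z \<in> U" for z using that out inv by metis+
  then have img: "\<phi> ` U = U" using inv by (metis image_subsetI image_eqI subsetI subset_antisym)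
  have cont: "continuous_on UNIV \<phi>" and inj: "inj \<phi>"
    using h(1) by (auto simp: homeomorphism_def intro: inj_on_inverseI)
  have "has_pair_log \<phi>"
  proof (rule has_pair_log_derivative[OF cont inj])
    show "(\<phi> has_derivative (\<lambda>v. v)) (at c)"
    proof (rule has_derivative_transform_within_open[of "\<lambda>z. z" _ c UNIV "- closure U"])
      fix z assume "z \<in> - closure U"
      then show "z = \<phi> z" using out(1)[of z] closure_subset by (metis ComplD subsetD)
    qed (use c in auto)
  qed auto
  then show ?thesis using that[OF h out(1) img] by blast
qed

text \<open>Outside \<open>U\<close> the push does nothing; a point of \<open>U\<close> stays in
  \<open>U\<close> under \<open>\<phi>\<close> and is then thrown out by \<open>h\<close>.\<close>

lemma free_homeo_push:
  assumes h: "free_homeo Q h" and U: "U \<subseteq> Q" "\<And>z. z \<in> U \<Longrightarrow> h z \<notin> U"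
    and \<phi>: "homeomorphism UNIV UNIV \<phi> \<psi>" "\<And>z. z \<notin> U \<Longrightarrow> \<phi> z = z" "\<phi> ` U = U" "has_pair_log \<phi>"
  shows "free_homeo Q (h \<circ> \<phi>)"
proof -
  obtain k where k: "homeomorphism UNIV UNIV h k" using h by (auto simp: free_homeo_def)
  have "\<phi> ` (Q - U) = Q - U" using \<phi>(2) by force
  then have "\<phi> ` Q = Q" using \<phi>(3) U(1) by (metis Diff_partition image_Un)
  then have "(h \<circ> \<phi>) ` Q = Q" using h by (metis free_homeo_simps(3) image_comp)
  moreover have "homeomorphism UNIV UNIV (h \<circ> \<phi>) (\<psi> \<circ> k)"
    using \<phi>(1) k by (rule homeomorphism_compose)
  moreover have "(h \<circ> \<phi>) z \<noteq> z" if "z \<in> Q" for z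
  proof (cases "z \<in> U")
    case True
    then have "\<phi> z \<in> U" using \<phi>(3) by blast
    then show ?thesis using U(2) True by force
  next
    case False
    then show ?thesis using \<phi>(2) free_homeo_simps(5)[OF h] that by simp
  qed
  moreover have "has_pair_log (h \<circ> \<phi>)"
    using h \<phi> by (intro has_pair_log_compose)
      (auto simp: free_homeo_def homeomorphism_def intro: inj_on_inverseI)
  ultimately show ?thesis unfolding free_homeo_def by blast
qed

text \<open>Follows an orbit of a modified map along a known sequence. The index is shifted because
  \<open>x\<close> itself need not be on the sequence.\<close>

lemma funpow_track:
  assumes "g x = s 0" "\<And>i. Suc i < m \<Longrightarrow> g (s i) = s (Suc i)" "i < m"
  shows "(g ^^ Suc i) x = s i"
  using assms(3) by (induction i) (use assms(1,2) in auto)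

text \<open>The map is quantified along with the point, so a least period is minimal over all maps
  and can be refuted by a modified map.\<close>

definition periodic_free_homeo :: "complex set \<Rightarrow> nat \<Rightarrow> bool" where
  "periodic_free_homeo Q n \<longleftrightarrow> 0 < n \<and> (\<exists>h x. free_homeo Q h \<and> x \<in> Q \<and> (h ^^ n) x = x)"

text \<open>
  Pushing the first return point back to \<open>p\<close> inside the free set \<open>U\<close> closes the orbit without
  creating fixed points.
\<close>
lemma return_imp_periodic:
  assumes h: "free_homeo Q h" and U: "open U" "connected U" "U \<subseteq> Q" "\<And>z. z \<in> U \<Longrightarrow> h z \<notin> U"
    and c: "c \<notin> closure Q" and ret: "p \<in> U" "(h ^^ n) p \<in> U" "0 < n"
  shows "\<exists>m\<le>n. periodic_free_homeo Q m"
proof -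
  \<comment> \<open>At the first return the orbit points in between lie outside \<open>U\<close>,
    where \<open>\<phi>\<close> is the identity.\<close>
  define m where "m = (LEAST m. 0 < m \<and> (h ^^ m) p \<in> U)"
  have m: "0 < m" "(h ^^ m) p \<in> U"
    unfolding m_def using LeastI[of "\<lambda>m. 0 < m \<and> (h ^^ m) p \<in> U" n] ret by auto
  have "m \<le> n" unfolding m_def using ret by (intro Least_le) auto
  have min: "(h ^^ i) p \<notin> U" if "0 < i" "i < m" for i
    using not_less_Least[of i "\<lambda>m. 0 < m \<and> (h ^^ m) p \<in> U"] that m_def by blast
  have "c \<notin> closure U" using c U(3) closure_mono by blast
  then obtain \<phi> \<psi> where \<phi>: "homeomorphism UNIV UNIV \<phi> \<psi>" "\<phi> ((h ^^ m) p) = p"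
      "\<And>z. z \<notin> U \<Longrightarrow> \<phi> z = z" "\<phi> ` U = U" "has_pair_log \<phi>"
    using pushing_homeomorphism[OF U(1,2) m(2) ret(1)] by blast
  \<comment> \<open>The closed orbit starts at the return point: \<open>\<phi>\<close> takes it to
    \<open>p\<close>, and from there \<open>g\<close> repeats the orbit of \<open>p\<close> up to
    the same point.\<close>
  define x where "x = (h ^^ m) p"
  define g where "g = h \<circ> \<phi>"
  obtain m' where m': "m = Suc m'" using m(1) gr0_implies_Suc by blast
  have "(g ^^ Suc m') x = (h ^^ Suc m') p"
  proof (rule funpow_track[where s = "\<lambda>i. (h ^^ Suc i) p" and m = m])
    show "g x = (h ^^ Suc 0) p" using \<phi>(2) by (simp add: x_def g_def)
    show "g ((h ^^ Suc i) p) = (h ^^ Suc (Suc i)) p" if "Suc i < m" for i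
      using \<phi>(3) min[OF zero_less_Suc that] by (simp add: g_def)
  qed (simp add: m')
  then have "(g ^^ m) x = x" by (simp only: m' x_def)
  moreover have "free_homeo Q g" unfolding g_def using free_homeo_push[OF h U(3,4) \<phi>(1,3,4,5)] by blast
  moreover have "x \<in> Q" using m(2) U(3) x_def by blast
  ultimately show ?thesis using \<open>m \<le> n\<close> m(1) unfolding periodic_free_homeo_def by blast
qed

text \<open>The neighbourhood is the image of \<open>K\<close> times a ball under addition.\<close>

lemma connected_nbhd:
  fixes K :: "'a::real_normed_vector set"
  assumes "connected K" "K \<noteq> {}" "0 < e"
  shows "connected (\<Union>x\<in>K. ball x e)"
proof -
  have "(\<Union>x\<in>K. ball x e) = (\<lambda>(x, v). x + v) ` (K \<times> ball 0 e)"
  proof (intro equalityI subsetI)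
    fix z assume "z \<in> (\<Union>x\<in>K. ball x e)"
    then obtain x where "x \<in> K" "dist x z < e" by auto
    then show "z \<in> (\<lambda>(x, v). x + v) ` (K \<times> ball 0 e)"
      by (intro image_eqI[where x = "(x, z - x)"]) (auto simp: dist_norm norm_minus_commute)
  next
    fix z assume "z \<in> (\<lambda>(x, v). x + v) ` (K \<times> ball 0 e)"
    then obtain x v where "x \<in> K" "norm v < e" "z = x + v" by auto
    then have "z \<in> ball x e" by (simp add: dist_norm)
    then show "z \<in> (\<Union>x\<in>K. ball x e)" using \<open>x \<in> K\<close> by blast
  qed
  moreover have "connected \<dots>"
    by (intro connected_continuous_image connected_Times assms)
       (auto intro!: continuous_intros simp: case_prod_unfold)
  ultimately show ?thesis by simp
qed

text \<open>The image of \<open>K\<close> has a positive distance \<open>r\<close> from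
  \<open>L\<close>, and a neighbourhood of \<open>K\<close> is mapped within \<open>r / 2\<close> of
  that image. All smaller radii are covered, so that several such conditions can share one
  radius.\<close>

lemma compact_separated_nbhds:
  fixes h :: "'a::euclidean_space \<Rightarrow> 'a"
  assumes h: "continuous_on UNIV h" and KL: "compact K" "compact L" and dis: "\<And>z. z \<in> K \<Longrightarrow> h z \<notin> L"
  shows "\<exists>e>0. \<forall>d\<in>{0<..e}. \<forall>z\<in>(\<Union>x\<in>K. ball x d). h z \<notin> (\<Union>x\<in>L. ball x d)"
proof -
  have cK: "compact (h ` K)"
    by (rule compact_continuous_image[OF continuous_on_subset[OF h] KL(1)]) simp
  obtain r where r: "0 < r" "\<And>x y. \<lbrakk>x \<in> h ` K; y \<in> L\<rbrakk> \<Longrightarrow> r \<le> dist x y"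
    using separate_compact_closed[OF cK, of L] KL(2) dis compact_imp_closed by blast
  define V where "V = h -` (\<Union>x\<in>h ` K. ball x (r / 2))"
  have "open V" unfolding V_def using h by (intro open_vimage) auto
  moreover have "x \<in> V" if "x \<in> K" for x
  proof -
    have "h x \<in> ball (h x) (r / 2)" using r(1) by simp
    then show ?thesis unfolding V_def using that by blast
  qed
  then have "K \<subseteq> V" by blast
  ultimately obtain e where e: "0 < e" "(\<Union>x\<in>K. ball x e) \<subseteq> V"
    using compact_subset_open_imp_ball_epsilon_subset KL(1) by blast
  show ?thesis
  proof (intro exI[of _ "min e (r / 2)"] conjI ballI)
    show "0 < min e (r / 2)" using e r by simp
    fix d z assume "d \<in> {0<..min e (r / 2)}" and z: "z \<in> (\<Union>x\<in>K. ball x d)"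
    then have d: "0 < d" "d \<le> e" "d \<le> r / 2" by auto
    have "z \<in> V" using z d(2) e(2) by fastforce
    then obtain x where x: "x \<in> h ` K" "dist x (h z) < r / 2" by (auto simp: V_def)
    show "h z \<notin> (\<Union>x\<in>L. ball x d)"
    proof
      assume "h z \<in> (\<Union>x\<in>L. ball x d)"
      then obtain y where y: "y \<in> L" "dist y (h z) < r / 2" using d by auto
      then have "dist x y < r" using x(2) dist_triangle_half_r[of "h z" x r y] by (simp add: dist_commute)
      then show False using r(2)[OF x(1) y(1)] by simp
    qed
  qed
qed

section \<open>The quadrant and its exhaustion\<close>

definition quadrant :: "complex set" where
  "quadrant = {z. 0 < Re z \<and> 0 < Im z}"

lemma open_quadrant: "open quadrant"
  unfolding quadrant_def
  by (intro open_Collect_conj open_Collect_less continuous_intros)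

lemma convex_quadrant: "convex quadrant"
  unfolding quadrant_def Collect_conj_eq
  by (intro convex_Int convex_halfspace_Re_gt convex_halfspace_Im_gt)

lemma not_in_closure_quadrant: "-1 \<notin> closure quadrant"
proof -
  have "closure quadrant \<subseteq> {z. 0 \<le> Re z}"
    by (intro closure_minimal closed_halfspace_Re_ge) (auto simp: quadrant_def)
  then show ?thesis by auto
qed

text \<open>An exhaustion of the quadrant by compact sets that are star-shaped around \<open>x\<close>.\<close>
definition exhaustion :: "complex \<Rightarrow> complex \<Rightarrow> real" where
  "exhaustion x z = norm (z - x) * (1 + 1 / Re z + 1 / Im z)"

lemma continuous_on_exhaustion: "continuous_on quadrant (exhaustion x)"
  unfolding exhaustion_def by (intro continuous_intros) (auto simp: quadrant_def)

lemma exhaustion_pos: "z \<in> quadrant \<Longrightarrow> z \<noteq> x \<Longrightarrow> 0 < exhaustion x z"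
  by (auto simp: exhaustion_def quadrant_def add_pos_pos)

text \<open>At parameter \<open>u\<close> the norm factor is multiplied by \<open>u\<close>, while
  \<open>Re z\<close> and \<open>Im z\<close> are at least \<open>u\<close> times those of
  \<open>w\<close>. The summand 1 makes the inequality strict.\<close>

lemma exhaustion_segment:
  assumes x: "x \<in> quadrant" and w: "w \<in> quadrant" and z: "z \<in> closed_segment x w"
  shows "z \<in> quadrant" "z = w \<or> exhaustion x z < exhaustion x w"
proof -
  show zQ: "z \<in> quadrant"
    using closed_segment_subset[OF x w convex_quadrant] z by blast
  obtain u where u: "0 \<le> u" "u \<le> 1" "z = (1 - u) *\<^sub>R x + u *\<^sub>R w"
    using z by (auto simp: closed_segment_def)
  have "exhaustion x z < exhaustion x w" if "z \<noteq> w"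
  proof -
    have "u \<noteq> 1" "w \<noteq> x" using u(3) that by (auto simp flip: scaleR_left_distrib)
    then have "u < 1" using u(2) by simp
    have Re: "u / Re z \<le> 1 / Re w" and Im: "u / Im z \<le> 1 / Im w"
    proof -
      have "0 \<le> (1 - u) * Re x" "0 \<le> (1 - u) * Im x" using u x by (auto simp: quadrant_def)
      then have "u * Re w \<le> Re z" "u * Im w \<le> Im z" by (simp_all add: u(3))
      then show "u / Re z \<le> 1 / Re w" "u / Im z \<le> 1 / Im w"
        using w zQ by (auto simp: quadrant_def field_simps)
    qed
    have "z - x = u *\<^sub>R (w - x)" using u(3) by (simp add: algebra_simps)
    then have "norm (z - x) = norm (w - x) * u" using u(1) by simp
    then have "exhaustion x z = norm (w - x) * (u + u / Re z + u / Im z)"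
      by (simp add: exhaustion_def algebra_simps)
    also have "\<dots> < norm (w - x) * (1 + 1 / Re w + 1 / Im w)"
      using Re Im \<open>u < 1\<close> \<open>w \<noteq> x\<close> by (intro mult_strict_left_mono) auto
    finally show ?thesis by (simp add: exhaustion_def)
  qed
  then show "z = w \<or> exhaustion x z < exhaustion x w" by blast
qed

text \<open>A short move towards \<open>x\<close> lowers the level and preserves the open condition
  on \<open>\<kappa>\<close>.\<close>

lemma exhaustion_decrease:
  assumes x: "x \<in> quadrant" and z: "z \<in> quadrant" "z \<noteq> x"
    and \<kappa>: "continuous_on quadrant \<kappa>" "\<kappa> z < r"
  obtains w where "w \<in> quadrant" "exhaustion x w < exhaustion x z" "\<kappa> w < (r :: real)"
proof -
  have "open {w \<in> quadrant. \<kappa> w < r}"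
    using continuous_open_preimage[OF \<kappa>(1) open_quadrant open_lessThan[of r]]
    by (simp add: vimage_def Int_def)
  then obtain d where d: "0 < d" "ball z d \<subseteq> {w \<in> quadrant. \<kappa> w < r}"
    using z \<kappa> by (auto simp: open_contains_ball)
  define t where "t = min (1 / 2) (d / (2 * norm (z - x)))"
  define w where "w = (1 - t) *\<^sub>R z + t *\<^sub>R x"
  have n: "0 < norm (z - x)" using z by simp
  have t: "0 < t" "t < 1" "t * norm (z - x) < d"
    using n d(1) by (auto simp: t_def min_def field_simps)
  have "dist z w = t * norm (z - x)"
    using t by (simp add: w_def dist_norm algebra_simps flip: scaleR_diff_right)
  then have wd: "w \<in> {w \<in> quadrant. \<kappa> w < r}" using t d(2) by (simp add: subset_iff)
  have "w \<in> closed_segment x z" using t by (auto simp: w_def closed_segment_def intro!: exI[of _ "1 - t"])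
  moreover have "w \<noteq> z" using t(1) z(2) by (simp add: w_def algebra_simps flip: scaleR_diff_right)
  ultimately show ?thesis using that[of w] wd exhaustion_segment(2)[OF x z(1)] by blast
qed

text \<open>Outside a compact part of the quadrant the function exceeds its value at
  \<open>x\<close>, so a minimum over that part is global.\<close>

lemma exhaustion_attains_inf:
  assumes x: "x \<in> quadrant" and h: "continuous_on quadrant h" "h ` quadrant \<subseteq> quadrant"
  obtains y where "y \<in> quadrant"
    "\<And>z. z \<in> quadrant \<Longrightarrow>
       max (exhaustion x y) (exhaustion x (h y)) \<le> max (exhaustion x z) (exhaustion x (h z))"
proof -
  define M where "M z = max (exhaustion x z) (exhaustion x (h z))" for z
  have contM: "continuous_on quadrant M"
    unfolding M_def
    by (intro continuous_intros continuous_on_exhaustion h continuous_on_compose2[OF continuous_on_exhaustion])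
  define r where "r = M x"
  have "0 \<le> r" by (simp add: r_def M_def exhaustion_def le_max_iff_disj)
  \<comment> \<open>Level at most \<open>r\<close> gives
    \<open>Re x - Re z \<le> norm (z - x) \<le> r * Re z\<close>, and likewise for
    \<open>Im\<close>; hence the two half-planes.\<close>
  define K where "K = cball x r \<inter> {z. Re x / (1 + r) \<le> Re z} \<inter> {z. Im x / (1 + r) \<le> Im z}"
  have KQ: "K \<subseteq> quadrant"
    using x \<open>0 \<le> r\<close> by (auto simp: K_def quadrant_def intro: less_le_trans[rotated])
  have sub: "z \<in> K" if z: "z \<in> quadrant" "exhaustion x z \<le> r" for z
  proof -
    have pos: "0 < Re z" "0 < Im z" using z(1) by (auto simp: quadrant_def)
    have bounds: "norm (z - x) \<le> r" "norm (z - x) / Re z \<le> r" "norm (z - x) / Im z \<le> r"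
      using z(2) pos unfolding exhaustion_def
      by (simp_all add: distrib_left) (smt (verit) divide_nonneg_pos norm_ge_zero)+
    have "Re x - Re z \<le> r * Re z"
      using bounds(2) pos abs_Re_le_cmod[of "z - x"] by (simp add: pos_divide_le_eq)
    moreover have "Im x - Im z \<le> r * Im z"
      using bounds(3) pos abs_Im_le_cmod[of "z - x"] by (simp add: pos_divide_le_eq)
    ultimately show ?thesis
      using bounds(1) \<open>0 \<le> r\<close>
      by (simp add: K_def dist_norm norm_minus_commute pos_divide_le_eq algebra_simps)
  qed
  have "compact K" unfolding K_def
    by (intro compact_Int_closed compact_cball closed_halfspace_Re_ge closed_halfspace_Im_ge)
  moreover have "x \<in> K" using sub[OF x] \<open>0 \<le> r\<close> by (simp add: exhaustion_def)
  ultimately obtain y where y: "y \<in> K" "\<And>z. z \<in> K \<Longrightarrow> M y \<le> M z"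
    using continuous_attains_inf[of K M] continuous_on_subset[OF contM KQ] by blast
  have min: "M y \<le> M z" if "z \<in> quadrant" for z
  proof (cases "z \<in> K")
    case False
    then have "r < exhaustion x z" using sub that by force
    moreover have "M y \<le> r" using y(2)[OF \<open>x \<in> K\<close>] r_def by simp
    ultimately show ?thesis unfolding M_def by linarith
  qed (use y in blast)
  have "y \<in> quadrant" using y(1) KQ by blast
  then show ?thesis using that[of y] min unfolding M_def by blast
qed

text \<open>A small neighbourhood of \<open>K\<close> is open, connected and still free, so the
  pushing argument applies to it.\<close>

lemma free_compact_return:
  assumes h: "free_homeo quadrant h" and K: "compact K" "connected K" "K \<subseteq> quadrant"
    and free: "\<And>z. z \<in> K \<Longrightarrow> h z \<notin> K" and ret: "p \<in> K" "(h ^^ n) p \<in> K" "0 < n"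
  shows "\<exists>m\<le>n. periodic_free_homeo quadrant m"
proof -
  obtain d where d: "0 < d" "(\<Union>x\<in>K. ball x d) \<subseteq> quadrant"
    using compact_subset_open_imp_ball_epsilon_subset[OF K(1) open_quadrant K(3)] by blast
  obtain e where e: "0 < e" "\<forall>d\<in>{0<..e}. \<forall>z\<in>(\<Union>x\<in>K. ball x d). h z \<notin> (\<Union>x\<in>K. ball x d)"
    using compact_separated_nbhds[OF free_homeo_simps(1)[OF h] K(1) K(1) free] by blast
  define c where "c = min d e"
  define U where "U = (\<Union>x\<in>K. ball x c)"
  have c: "0 < c" "c \<le> d" "c \<le> e" using d e by (auto simp: c_def)
  have KU: "K \<subseteq> U" using c(1) by (force simp: U_def)
  show ?thesis
  proof (rule return_imp_periodic[OF h _ _ _ _ not_in_closure_quadrant _ _ ret(3)])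
    show "open U" by (auto simp: U_def)
    show "connected U" unfolding U_def using K(2) ret(1) c(1) by (intro connected_nbhd) auto
    show "U \<subseteq> quadrant"
      using d(2) c(2) by (fastforce simp: U_def)
    show "h z \<notin> U" if "z \<in> U" for z
      using bspec[OF e(2), of c] c(1,3) that unfolding U_def greaterThanAtMost_iff by blast
    show "p \<in> U" "(h ^^ n) p \<in> U" using ret KU by auto
  qed
qed

text \<open>
  Let the period \<open>n \<ge> 3\<close> of \<open>x\<close> be minimal, and let \<open>y\<close> minimise the level of the exhaustion
  at which a point and its image are both caught. Put \<open>A = [x, y]\<close> and \<open>B = [x, h y]\<close>. If
  \<open>h (h w) \<in> B\<close> for some \<open>w \<in> A\<close>, the segments from \<open>x\<close> to \<open>w\<close> and to \<open>h (h w)\<close> form a free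
  connected set with return time two. Otherwise pushes near \<open>B\<close> and \<open>h A\<close> carry \<open>x\<close> to \<open>h y\<close>
  and on to \<open>h x\<close>, which shortens the orbit of \<open>x\<close> by one point.
\<close>
theorem no_periodic_free_homeo: "\<not> periodic_free_homeo quadrant n"
proof
  assume "periodic_free_homeo quadrant n"
  define n where "n = (LEAST n. periodic_free_homeo quadrant n)"
  have "periodic_free_homeo quadrant n"
    unfolding n_def using \<open>periodic_free_homeo quadrant _\<close> by (rule LeastI)
  then obtain h x where "0 < n" and h: "free_homeo quadrant h" and x: "x \<in> quadrant" "(h ^^ n) x = x"
    by (auto simp: periodic_free_homeo_def)
  have least: "n \<le> m" if "periodic_free_homeo quadrant m" for m
    unfolding n_def using that by (rule Least_le)
  have cont: "continuous_on A h" for A using free_homeo_simps(1)[OF h] .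
  have inj: "inj h" using free_homeo_simps(2)[OF h] .
  have hQ: "h z \<in> quadrant" "h z \<noteq> z" if "z \<in> quadrant" for z
    using that free_homeo_simps(4,5)[OF h] by auto
  have no_two: "h (h z) \<noteq> z" if "z \<in> quadrant" for z
    using no_period_two[OF convex_quadrant cont _ hQ(2) free_homeo_simps(6)[OF h] that] hQ(1)
    by blast
  have "n \<noteq> 1" using x hQ(2) by auto
  moreover have "n \<noteq> 2" using x no_two by (auto simp: numeral_2_eq_2)
  ultimately have "3 \<le> n" using \<open>0 < n\<close> by simp
  let ?\<rho> = "exhaustion x"
  obtain k where k: "homeomorphism UNIV UNIV h k" using h by (auto simp: free_homeo_def)
  have kh: "k (h z) = z" "h (k z) = z" for z using k by (auto simp: homeomorphism_def)
  have kQ: "k z \<in> quadrant" if "z \<in> quadrant" for z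
    using that free_homeo_simps(3)[OF h] kh by (metis imageE)
  have contk: "continuous_on A k" for A
    using k continuous_on_subset by (auto simp: homeomorphism_def)
  obtain y where y: "y \<in> quadrant"
      and y_min: "\<And>z. z \<in> quadrant \<Longrightarrow> max (?\<rho> y) (?\<rho> (h y)) \<le> max (?\<rho> z) (?\<rho> (h z))"
    using exhaustion_attains_inf[OF x(1) cont[of quadrant]] free_homeo_simps(3)[OF h] by blast
  define r where "r = max (?\<rho> y) (?\<rho> (h y))"
  have r_le: "r \<le> max (?\<rho> z) (?\<rho> (h z))" if "z \<in> quadrant" for z
    using y_min[OF that] r_def by simp
  have "0 < r"
    using exhaustion_pos[OF y, of x] exhaustion_pos[OF hQ(1)[OF y], of x] hQ(2)[OF y]
    by (auto simp: r_def less_max_iff_disj)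
  have at_x: "?\<rho> x = 0" by (simp add: exhaustion_def)
  \<comment> \<open>If one of the two levels were below \<open>r\<close>, moving \<open>z\<close>
    towards \<open>x\<close>, or \<open>h z\<close> together with its preimage under
    \<open>k\<close>, would bring both below the minimum.\<close>
  have both: "?\<rho> z = r" "?\<rho> (h z) = r" if z: "z \<in> quadrant" "?\<rho> z \<le> r" "?\<rho> (h z) \<le> r" for z
  proof -
    show "?\<rho> (h z) = r"
    proof (rule ccontr)
      assume "?\<rho> (h z) \<noteq> r"
      then have lt: "?\<rho> (h z) < r" using z by simp
      then have "z \<noteq> x" using r_le[OF z(1)] at_x \<open>0 < r\<close> by auto
      obtain w where "w \<in> quadrant" "?\<rho> w < ?\<rho> z" "?\<rho> (h w) < r"
        by (rule exhaustion_decrease[OF x(1) z(1) \<open>z \<noteq> x\<close>, of "\<lambda>w. ?\<rho> (h w)" r])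
          (use lt hQ in \<open>auto intro!: continuous_on_compose2[OF continuous_on_exhaustion] cont\<close>)
      then show False using r_le[of w] z(2) by auto
    qed
    show "?\<rho> z = r"
    proof (rule ccontr)
      assume "?\<rho> z \<noteq> r"
      then have lt: "?\<rho> z < r" using z by simp
      then have "h z \<noteq> x" using r_le[OF z(1)] at_x \<open>0 < r\<close> by auto
      obtain w where "w \<in> quadrant" "?\<rho> w < ?\<rho> (h z)" "?\<rho> (k w) < r"
        by (rule exhaustion_decrease[OF x(1) hQ(1)[OF z(1)] \<open>h z \<noteq> x\<close>, of "\<lambda>w. ?\<rho> (k w)" r])
          (use lt kQ kh in \<open>auto intro!: continuous_on_compose2[OF continuous_on_exhaustion] contk\<close>)
      then show False using r_le[of "k w"] z(3) kQ kh by auto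
    qed
  qed
  have \<rho>y: "?\<rho> y = r" "?\<rho> (h y) = r" using both[OF y] by (auto simp: r_def)
  define A where "A = closed_segment x y"
  define B where "B = closed_segment x (h y)"
  have AQ: "z \<in> quadrant" "z = y \<or> ?\<rho> z < r" if "z \<in> A" for z
    using exhaustion_segment[OF x(1) y] that \<rho>y by (auto simp: A_def)
  have BQ: "z \<in> quadrant" "z = h y \<or> ?\<rho> z < r" if "z \<in> B" for z
    using exhaustion_segment[OF x(1) hQ(1)[OF y]] that \<rho>y by (auto simp: B_def)
  have xAB: "x \<in> A" "x \<in> B" "y \<in> A" "h y \<in> B" by (auto simp: A_def B_def)
  have yB: "y \<notin> B" using BQ(2)[of y] \<rho>y hQ(2)[OF y] by auto
  have hyA: "h y \<notin> A" using AQ(2)[of "h y"] \<rho>y hQ(2)[OF y] by auto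
  \<comment> \<open>On the two segments only \<open>y\<close> and \<open>h y\<close> reach level
    \<open>r\<close>; running from \<open>h y\<close> to \<open>y\<close> would give period
    two.\<close>
  have only_y: "z = y" if z: "z \<in> A \<union> B" "h z \<in> A \<union> B" for z
  proof -
    have zQ: "z \<in> quadrant" using z(1) AQ BQ by blast
    have "?\<rho> z \<le> r" "?\<rho> (h z) \<le> r" using z AQ(2) BQ(2) \<rho>y by fastforce+
    then have "?\<rho> z = r" "?\<rho> (h z) = r" using both zQ by auto
    then have "z \<in> {y, h y}" "h z \<in> {y, h y}" using z AQ(2) BQ(2) by fastforce+
    then show ?thesis using hQ(2)[OF zQ] no_two[OF y] by auto
  qed
  have freeA: "h z \<notin> A" if "z \<in> A" for z using only_y[of z] that hyA by auto
  have freeB: "h z \<notin> B" if "z \<in> B" for z using only_y[of z] that yB by auto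
  have far: "h (h w) \<notin> B" if w: "w \<in> A" for w
  proof
    assume hhw: "h (h w) \<in> B"
    define K where "K = closed_segment x w \<union> closed_segment x (h (h w))"
    have sub: "closed_segment x w \<subseteq> A" "closed_segment x (h (h w)) \<subseteq> B"
      using w hhw xAB by (auto simp: A_def B_def closed_segment_subset)
    have wQ: "w \<in> quadrant" "h (h w) \<in> quadrant" using w AQ hQ by auto
    \<comment> \<open>Otherwise \<open>z = y\<close> would force \<open>w = y\<close> and
      \<open>h (h w) = h y\<close>, and injectivity would make \<open>y\<close> a fixed
      point.\<close>
    have "h z \<notin> K" if "z \<in> K" for z
    proof
      assume "h z \<in> K"
      then have "z = y" using only_y[of z] that sub by (auto simp: K_def)
      have "y = w"
        using exhaustion_segment(2)[OF x(1) wQ(1), of y] AQ(2)[OF w] \<rho>y sub yB that \<open>z = y\<close>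
        by (auto simp: K_def)
      moreover have "h y = h (h w)"
        using exhaustion_segment(2)[OF x(1) wQ(2), of "h y"] BQ(2)[OF hhw] \<rho>y sub hyA
          \<open>h z \<in> K\<close> \<open>z = y\<close> by (auto simp: K_def)
      ultimately show False using hQ(2)[OF y] inj by (metis injD)
    qed
    moreover have "connected K" unfolding K_def by (intro connected_Un) auto
    moreover have "compact K" by (auto simp: K_def)
    moreover have "K \<subseteq> quadrant" using sub AQ(1) BQ(1) by (auto simp: K_def)
    moreover have "w \<in> K" "(h ^^ 2) w \<in> K" by (auto simp: K_def numeral_2_eq_2)
    ultimately obtain m where "m \<le> 2" "periodic_free_homeo quadrant m"
      using free_compact_return[OF h, of K w 2] by auto
    then show False using least \<open>3 \<le> n\<close> by fastforce
  qed
  define C where "C = h ` A"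
  have compact: "compact A" "compact B" "compact C"
    by (auto simp: A_def B_def C_def intro!: compact_continuous_image cont)
  have connected: "connected B" "connected C"
    by (auto simp: A_def B_def C_def intro!: connected_continuous_image cont)
  have freeC: "h z \<notin> C" if "z \<in> C" for z
    using that freeA inj by (auto simp: C_def inj_image_mem_iff)
  have freeCB: "h z \<notin> B" if "z \<in> C" for z
    using that far by (auto simp: C_def)
  have sub: "B \<union> C \<subseteq> quadrant" using AQ(1) BQ(1) hQ(1) by (auto simp: C_def)
  obtain d where d: "0 < d" "(\<Union>x\<in>B \<union> C. ball x d) \<subseteq> quadrant"
    using compact_subset_open_imp_ball_epsilon_subset[OF compact_Un open_quadrant sub] compact
    by blast
  obtain e1 where e1: "0 < e1" "\<forall>d\<in>{0<..e1}. \<forall>z\<in>(\<Union>x\<in>B. ball x d). h z \<notin> (\<Union>x\<in>B. ball x d)"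
    using compact_separated_nbhds[OF cont compact(2,2) freeB] by blast
  obtain e2 where e2: "0 < e2" "\<forall>d\<in>{0<..e2}. \<forall>z\<in>(\<Union>x\<in>C. ball x d). h z \<notin> (\<Union>x\<in>C. ball x d)"
    using compact_separated_nbhds[OF cont compact(3,3) freeC] by blast
  obtain e3 where e3: "0 < e3" "\<forall>d\<in>{0<..e3}. \<forall>z\<in>(\<Union>x\<in>C. ball x d). h z \<notin> (\<Union>x\<in>B. ball x d)"
    using compact_separated_nbhds[OF cont compact(3,2) freeCB] by blast
  \<comment> \<open>One radius keeps both neighbourhoods in the quadrant, makes each of them free,
    and prevents the one of \<open>C\<close> from being mapped into the one of
    \<open>B\<close>.\<close>
  define e where "e = min (min d e1) (min e2 e3)"
  have e: "0 < e" "e \<le> d" "e \<le> e1" "e \<le> e2" "e \<le> e3" using d(1) e1(1) e2(1) e3(1) by (auto simp: e_def)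
  define U where "U = (\<Union>x\<in>B. ball x e)"
  define V where "V = (\<Union>x\<in>C. ball x e)"
  have UV_open: "open U" "open V" by (auto simp: U_def V_def)
  have UV_connected: "connected U" "connected V"
    unfolding U_def V_def using connected xAB e(1) C_def by (intro connected_nbhd; blast)+
  have BU: "B \<subseteq> U" "C \<subseteq> V" unfolding U_def V_def using centre_in_ball[of _ e] e(1) by blast+
  have UV_sub: "U \<subseteq> quadrant" "V \<subseteq> quadrant"
    using d(2) subset_ball[OF e(2)] unfolding U_def V_def by blast+
  have UU: "h z \<notin> U" if "z \<in> U" for z 
    using bspec[OF e1(2), of e] e(1,3) that unfolding U_def greaterThanAtMost_iff by blast
  have VV: "h z \<notin> V" if "z \<in> V" for z 
    using bspec[OF e2(2), of e] e(1,4) that unfolding V_def greaterThanAtMost_iff by blast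
  have VU: "h z \<notin> U" if "z \<in> V" for z 
    using bspec[OF e3(2), of e] e(1,5) that unfolding V_def U_def greaterThanAtMost_iff by blast
  have closures: "-1 \<notin> closure U" "-1 \<notin> closure V"
    using UV_sub[THEN closure_mono] not_in_closure_quadrant by blast+
  have "x \<in> U" "h y \<in> U" "h y \<in> V" "h x \<in> V" using BU xAB by (auto simp: C_def)
  obtain \<phi> \<phi>' where \<phi>: "homeomorphism UNIV UNIV \<phi> \<phi>'" "\<phi> x = h y" "\<And>z. z \<notin> U \<Longrightarrow> \<phi> z = z"
      "\<phi> ` U = U" "has_pair_log \<phi>"
    using pushing_homeomorphism[OF UV_open(1) UV_connected(1) \<open>x \<in> U\<close> \<open>h y \<in> U\<close> closures(1)] by blast
  obtain \<psi> \<psi>' where \<psi>: "homeomorphism UNIV UNIV \<psi> \<psi>'" "\<psi> (h y) = h x" "\<And>z. z \<notin> V \<Longrightarrow> \<psi> z = z"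
      "\<psi> ` V = V" "has_pair_log \<psi>"
    using pushing_homeomorphism[OF UV_open(2) UV_connected(2) \<open>h y \<in> V\<close> \<open>h x \<in> V\<close> closures(2)] by blast
  define g where "g = h \<circ> \<psi> \<circ> \<phi>"
  have h\<psi>: "free_homeo quadrant (h \<circ> \<psi>)"
    using free_homeo_push[OF h UV_sub(2) VV \<psi>(1,3,4,5)] .
  \<comment> \<open>A point of \<open>V\<close> stays in \<open>V\<close> under
    \<open>\<psi>\<close>, and \<open>VU\<close> keeps its image out of \<open>U\<close>; elsewhere
    \<open>\<psi>\<close> is the identity.\<close>
  have "(h \<circ> \<psi>) z \<notin> U" if "z \<in> U" for z
    using that \<psi>(3,4) UU VU by (cases "z \<in> V") auto
  then have g: "free_homeo quadrant g"
    unfolding g_def using free_homeo_push[OF h\<psi> UV_sub(1) _ \<phi>(1,3,4,5)] by blast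
  \<comment> \<open>A return within \<open>j < n\<close> steps would produce a period at most
    \<open>j\<close>, against minimality. For \<open>V\<close> the steps are counted from
    \<open>h x\<close>, hence \<open>Suc j\<close>.\<close>
  have "(h ^^ j) x \<notin> U" if "0 < j" "j < n" for j
  proof
    assume ret: "(h ^^ j) x \<in> U"
    obtain m where "m \<le> j" "periodic_free_homeo quadrant m"
      using return_imp_periodic[OF h UV_open(1) UV_connected(1) UV_sub(1) UU not_in_closure_quadrant
          \<open>x \<in> U\<close> ret \<open>0 < j\<close>] by blast
    then show False using least[of m] that by simp
  qed
  moreover have "(h ^^ Suc j) x \<notin> V" if "0 < j" "j < n" for j
  proof
    assume "(h ^^ Suc j) x \<in> V"
    then have ret: "(h ^^ j) (h x) \<in> V" by (simp only: funpow_Suc_right o_apply)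
    obtain m where "m \<le> j" "periodic_free_homeo quadrant m"
      using return_imp_periodic[OF h UV_open(2) UV_connected(2) UV_sub(2) VV not_in_closure_quadrant
          \<open>h x \<in> V\<close> ret \<open>0 < j\<close>] by blast
    then show False using least[of m] that by simp
  qed
  ultimately have fixed: "\<phi> ((h ^^ Suc (Suc j)) x) = (h ^^ Suc (Suc j)) x"
      "\<psi> ((h ^^ Suc (Suc j)) x) = (h ^^ Suc (Suc j)) x" if "Suc (Suc j) < n" for j
    using \<phi>(3) \<psi>(3) that by (blast intro: Suc_lessD)+
  obtain n' where n': "n = Suc (Suc n')" "0 < n'" using that[of "n - 2"] \<open>3 \<le> n\<close> by simp
  \<comment> \<open>The first step passes from \<open>x\<close> through \<open>h y\<close> and
    \<open>h x\<close> to \<open>h (h x)\<close>, which costs one iteration instead of two. From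
    then on both pushes fix the orbit points until it closes.\<close>
  have "(g ^^ Suc n') x = (h ^^ Suc (Suc n')) x"
  proof (rule funpow_track[where s = "\<lambda>i. (h ^^ Suc (Suc i)) x" and m = "Suc n'"])
    show "g x = (h ^^ Suc (Suc 0)) x" by (simp add: g_def \<phi>(2) \<psi>(2))
    show "g ((h ^^ Suc (Suc i)) x) = (h ^^ Suc (Suc (Suc i))) x" if "Suc i < Suc n'" for i
      using fixed[of i] that n' by (simp add: g_def)
  qed simp
  then have "(g ^^ (n - 1)) x = x" using x(2) by (simp only: n' diff_Suc_1)
  then have "periodic_free_homeo quadrant (n - 1)"
    using g x \<open>3 \<le> n\<close> unfolding periodic_free_homeo_def by auto
  then show False using least[of "n - 1"] \<open>3 \<le> n\<close> by simp
qed

corollary no_return: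
  assumes h: "free_homeo quadrant h" and U: "open U" "connected U" "U \<subseteq> quadrant"
    and free: "\<And>z. z \<in> U \<Longrightarrow> h z \<notin> U" and p: "p \<in> U" "0 < n"
  shows "(h ^^ n) p \<notin> U"
proof
  assume "(h ^^ n) p \<in> U"
  then have "\<exists>m\<le>n. periodic_free_homeo quadrant m"
    by (intro return_imp_periodic[OF h U free not_in_closure_quadrant p(1) _ p(2)])
  then show False using no_periodic_free_homeo by simp
qed

section \<open>Saddles that commute with the reflections in the coordinate axes\<close>

lemma pos_on_connected:
  fixes g :: "'a::topological_space \<Rightarrow> real"
  assumes "connected S" "continuous_on S g" "\<And>x. x \<in> S \<Longrightarrow> g x \<noteq> 0" "a \<in> S" "0 < g a" "x \<in> S"
  shows "0 < g x"
proof (rule ccontr)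
  assume "\<not> 0 < g x"
  moreover have "connected (g ` S)" using assms(1,2) by (intro connected_continuous_image)
  ultimately have "0 \<in> g ` S"
    using connectedD_interval[of "g ` S" "g x" "g a" 0] assms(4-6) by auto
  then show False using assms(3) by auto
qed

text \<open>\<open>t - \<phi> t\<close> keeps its sign on the half-line, so orbits decrease, and a
  positive limit would be a fixed point.\<close>

lemma funpow_tendsto_0:
  fixes \<phi> :: "real \<Rightarrow> real"
  assumes cont: "continuous_on UNIV \<phi>" and pos: "\<And>x. 0 < x \<Longrightarrow> 0 < \<phi> x"
    and nofix: "\<And>x. 0 < x \<Longrightarrow> \<phi> x \<noteq> x" and a: "0 < a" "\<phi> a < a" and x: "0 < x"
  shows "(\<lambda>n. (\<phi> ^^ n) x) \<longlonglongrightarrow> 0"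
proof -
  have dec: "\<phi> t < t" if "0 < t" for t
    using pos_on_connected[of "{0<..}" "\<lambda>t. t - \<phi> t" a t] a that nofix
    by (force intro!: continuous_intros continuous_on_subset[OF cont])
  have X: "0 < (\<phi> ^^ n) x" for n by (induction n) (simp_all add: x pos)
  have "decseq (\<lambda>n. (\<phi> ^^ n) x)" by (rule decseq_SucI) (use X dec less_imp_le in auto)
  then obtain L where L: "(\<lambda>n. (\<phi> ^^ n) x) \<longlonglongrightarrow> L"
    using decseq_convergent[of "\<lambda>n. (\<phi> ^^ n) x" 0] X less_imp_le by metis
  have "0 \<le> L" using L X by (intro LIMSEQ_le_const) (auto intro: less_imp_le)
  have "isCont \<phi> L" using cont by (simp add: continuous_on_eq_continuous_at)
  then have "(\<lambda>n. \<phi> ((\<phi> ^^ n) x)) \<longlonglongrightarrow> \<phi> L" using L by (rule isCont_tendsto_compose)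
  moreover have "(\<lambda>n. \<phi> ((\<phi> ^^ n) x)) \<longlonglongrightarrow> L" using LIMSEQ_Suc[OF L] by simp
  ultimately have "\<phi> L = L" by (rule LIMSEQ_unique)
  then have "\<not> 0 < L" using nofix by blast
  then have "L = 0" using \<open>0 \<le> L\<close> by simp
  then show ?thesis using L by simp
qed

text \<open>An orbit not tending to infinity keeps re-entering some ball. By compactness it finally
  avoids the annulus \<open>A\<close>, and from the small inner ball one step cannot jump across
  \<open>A\<close>.\<close>

lemma tendsto_0_or_at_top:
  fixes X :: "nat \<Rightarrow> 'a::{real_normed_vector,heine_borel}"
  assumes X: "\<And>n. X (Suc n) = f (X n)" and f: "isCont f 0" "f 0 = 0"
    and fin: "\<And>q. q \<noteq> 0 \<Longrightarrow> \<exists>e>0. finite {n. X n \<in> ball q e}"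
  shows "X \<longlonglongrightarrow> 0 \<or> filterlim (\<lambda>n. norm (X n)) at_top sequentially"
proof (rule disjCI)
  assume "\<not> filterlim (\<lambda>n. norm (X n)) at_top sequentially"
  then obtain R0 where R0: "\<exists>\<^sub>F n in sequentially. norm (X n) < R0"
    by (auto simp: filterlim_at_top not_eventually not_le)
  define R where "R = max R0 1"
  obtain \<delta>0 where \<delta>0: "0 < \<delta>0" "\<And>z. norm z < \<delta>0 \<Longrightarrow> norm (f z) < R"
    using f unfolding continuous_at_eps_delta by (metis R_def dist_0_norm dist_commute less_max_iff_disj zero_less_one)
  show "X \<longlonglongrightarrow> 0"
  proof (rule LIMSEQ_I)
    fix r :: real assume "0 < r"
    define \<delta> where "\<delta> = min \<delta>0 (min r R)"
    have \<delta>: "0 < \<delta>" "\<delta> \<le> \<delta>0" "\<delta> \<le> r" using \<delta>0(1) \<open>0 < r\<close> by (auto simp: \<delta>_def R_def)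
    define A where "A = cball (0::'a) R - ball 0 \<delta>"
    have "compact A" unfolding A_def by (intro compact_diff) auto
    obtain e where e: "\<And>q. q \<in> A \<Longrightarrow> 0 < e q \<and> finite {n. X n \<in> ball q (e q)}"
    proof -
      have "q \<noteq> 0" if "q \<in> A" for q using that \<delta>(1) by (auto simp: A_def)
      then show ?thesis using fin that by metis
    qed
    have "\<exists>C\<subseteq>A. finite C \<and> A \<subseteq> (\<Union>q\<in>C. ball q (e q))"
      by (rule compactE_image[OF \<open>compact A\<close>, of A "\<lambda>q. ball q (e q)"]) (use e in auto)
    then obtain C where C: "C \<subseteq> A" "finite C" "A \<subseteq> (\<Union>q\<in>C. ball q (e q))" by blast
    have "{n. X n \<in> A} \<subseteq> (\<Union>q\<in>C. {n. X n \<in> ball q (e q)})" using C(3) by blast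
    moreover have "finite (\<Union>q\<in>C. {n. X n \<in> ball q (e q)})" using C e by blast
    ultimately have "finite {n. X n \<in> A}" by (rule finite_subset)
    then obtain N where N: "\<And>n. N \<le> n \<Longrightarrow> X n \<notin> A"
      by (metis finite_nat_set_iff_bounded_le mem_Collect_eq not_less_eq_eq)
    obtain n0 where n0: "N \<le> n0" "norm (X n0) < R0"
      using R0 by (auto simp: frequently_sequentially)
    have "norm (X n) < \<delta>" if "n0 \<le> n" for n
      using that
    proof (induction n rule: dec_induct)
      case base
      then show ?case using N[OF n0(1)] n0(2) by (auto simp: A_def R_def)
    next
      case (step n)
      then have "norm (X (Suc n)) < R" using \<delta>0(2) \<delta>(2) by (simp add: X)
      then show ?case using N[of "Suc n"] n0(1) step by (auto simp: A_def)
    qed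
    then show "\<exists>no. \<forall>n\<ge>no. norm (X n - 0) < r" using \<delta>(3) by force
  qed
qed

lemma funpow_commute:
  assumes "\<And>z. h (s z) = s (h z)"
  shows "(h ^^ n) (s z) = s ((h ^^ n) z)"
  by (induction n) (simp_all add: assms)

lemma funpow_cancel:
  assumes "\<And>z. f (g z) = z" "i \<le> j"
  shows "(f ^^ (j - i)) ((g ^^ j) z) = (g ^^ i) z"
proof -
  have "(f ^^ k) ((g ^^ (k + i)) z) = (g ^^ i) z" for k
    by (induction k) (simp_all add: assms(1) funpow_swap1[of f])
  from this[of "j - i"] show ?thesis using assms(2) by simp
qed

lemma finite_at_most_one:
  assumes "\<And>i j :: nat. \<lbrakk>i \<in> S; j \<in> S; i < j\<rbrakk> \<Longrightarrow> False"
  shows "finite S"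
proof (cases "S = {}")
  case False
  then obtain i where "i \<in> S" by blast
  then have "S \<subseteq> {i}" using assms by (metis insertI1 linorder_neqE_nat subsetI singleton_iff)
  then show ?thesis using finite_subset by blast
qed simp

text \<open>The real axis is the contracting direction; \<open>cnj\<close> and its negative are the
  reflections in the two axes.\<close>

locale symmetric_saddle =
  fixes F G :: "complex \<Rightarrow> complex" and F' :: "complex \<Rightarrow> complex \<Rightarrow> complex" and l m :: real
  assumes homeo: "homeomorphism UNIV UNIV F G"
    and cnj: "F (cnj z) = cnj (F z)" and minus_cnj: "F (- cnj z) = - cnj (F z)"
    and fixed: "F z = z \<Longrightarrow> z = 0"
    and deriv: "(F has_derivative F' z) (at z)"
    and deriv_cont: "isCont (\<lambda>z. F' z v) 0"
    and deriv_0: "F' 0 v = Complex (l * Re v) (m * Im v)"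
    and lm: "0 < l" "l < 1" "1 < m"
begin

section \<open>Invariance of the axes and half-planes\<close>

lemma FG [simp]: "F (G z) = z" "G (F z) = z"
  using homeo by (auto simp: homeomorphism_def)

lemma continuous_F: "continuous_on A F" and continuous_G: "continuous_on A G"
  using homeo continuous_on_subset by (auto simp: homeomorphism_def)

lemma F_eq_iff: "F z = F w \<longleftrightarrow> z = w"
  by (metis FG(2))

lemma minus: "F (- z) = - F z"
  using cnj[of z] minus_cnj[of "cnj z"] by simp

lemma F_0 [simp]: "F 0 = 0"
  using minus[of 0] by simp

lemma G_sym: "G (cnj z) = cnj (G z)" "G (- z) = - G z"
  using cnj[of "G z"] minus[of "G z"] by (metis FG)+

text \<open>The real axis is the fixed-point set of conjugation, with which the injective map
  \<open>F\<close> commutes.\<close>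

lemma Im_F_eq_0: "Im (F z) = 0 \<longleftrightarrow> Im z = 0"
proof -
  have "Im w = 0 \<longleftrightarrow> cnj w = w" for w by (auto simp: complex_eq_iff)
  then show ?thesis using cnj[of z] F_eq_iff by metis
qed

lemma Re_F_eq_0: "Re (F z) = 0 \<longleftrightarrow> Re z = 0"
proof -
  have "Re w = 0 \<longleftrightarrow> - cnj w = w" for w by (auto simp: complex_eq_iff)
  then show ?thesis using minus_cnj[of z] F_eq_iff by metis
qed

lemma DERIV_Re: "((\<lambda>t. Re (F (z + of_real t * v))) has_real_derivative Re (F' (z + of_real t * v) v)) (at t)"
  and DERIV_Im: "((\<lambda>t. Im (F (z + of_real t * v))) has_real_derivative Im (F' (z + of_real t * v) v)) (at t)"
proof -
  interpret bounded_linear "F' w" for w using deriv by (rule has_derivative_bounded_linear)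
  have "((\<lambda>t::real. z + of_real t * v) has_derivative (\<lambda>s. of_real s * v)) (at t)"
    by (auto intro!: derivative_eq_intros)
  from diff_chain_at[OF this deriv]
  have D: "((\<lambda>t. F (z + of_real t * v)) has_derivative (\<lambda>s. s *\<^sub>R F' (z + of_real t * v) v)) (at t)"
    by (simp add: o_def scaleR flip: scaleR_conv_of_real)
  show "((\<lambda>t. Re (F (z + of_real t * v))) has_real_derivative Re (F' (z + of_real t * v) v)) (at t)"
    unfolding has_field_derivative_def
    by (rule has_derivative_eq_rhs[OF has_derivative_Re[OF D]]) (simp add: fun_eq_iff mult.commute)
  show "((\<lambda>t. Im (F (z + of_real t * v))) has_real_derivative Im (F' (z + of_real t * v) v)) (at t)"
    unfolding has_field_derivative_def
    by (rule has_derivative_eq_rhs[OF has_derivative_Im[OF D]]) (simp add: fun_eq_iff mult.commute)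
qed

text \<open>One small \<open>t\<close> records what the derivative says about both axes;
  connectedness and the absence of fixed points then spread these inequalities.\<close>

lemma F_small:
  obtains t where "0 < t" "0 < Re (F (of_real t))" "Re (F (of_real t)) < t" "t < Im (F (\<i> * of_real t))"
proof -
  have 1: "((\<lambda>t. Re (F (0 + of_real t * 1))) has_real_derivative l) (at 0)"
    using DERIV_Re[of 0 1 0] by (simp add: deriv_0)
  have 2: "((\<lambda>t. Im (F (0 + of_real t * \<i>))) has_real_derivative m) (at 0)"
    using DERIV_Im[of 0 \<i> 0] by (simp add: deriv_0)
  have "((\<lambda>t. t - Re (F (0 + of_real t * 1))) has_real_derivative 1 - l) (at 0)"
    "((\<lambda>t. Im (F (0 + of_real t * \<i>)) - t) has_real_derivative m - 1) (at 0)"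
    by (auto intro!: derivative_intros 1[simplified] 2[simplified])
  from DERIV_pos_inc_right[OF this(1)] DERIV_pos_inc_right[OF this(2)] DERIV_pos_inc_right[OF 1]
  obtain d1 d2 d3 where d: "0 < d1" "0 < d2" "0 < d3"
      "\<And>t. \<lbrakk>0 < t; t < d1\<rbrakk> \<Longrightarrow> Re (F (of_real t)) < t"
      "\<And>t. \<lbrakk>0 < t; t < d2\<rbrakk> \<Longrightarrow> t < Im (F (of_real t * \<i>))"
      "\<And>t. \<lbrakk>0 < t; t < d3\<rbrakk> \<Longrightarrow> 0 < Re (F (of_real t))"
    using lm by auto
  define t where "t = min d1 (min d2 d3) / 2"
  have "0 < t" "t < d1" "t < d2" "t < d3" using d(1-3) by (auto simp: t_def)
  then show ?thesis using that[of t] d(4-6)[of t] by (simp add: mult.commute)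
qed

text \<open>\<open>Re (F z)\<close> has no zero in the right half-plane, so one small real point
  decides its sign there; oddness settles the left half-plane.\<close>

lemma Re_F_pos: "0 < Re (F z) \<longleftrightarrow> 0 < Re z"
proof -
  have *: "0 < Re (F z)" if "0 < Re z" for z
  proof -
    obtain t where "0 < t" "0 < Re (F (of_real t))" by (rule F_small)
    then show ?thesis
      using that by (intro pos_on_connected[of "{z. 0 < Re z}" "\<lambda>z. Re (F z)" "of_real t" z]
          continuous_intros continuous_F convex_connected[OF convex_halfspace_Re_gt])
        (auto simp: Re_F_eq_0)
  qed
  show ?thesis using *[of z] *[of "- z"] Re_F_eq_0[of z] by (fastforce simp: minus)
qed

lemma Im_F_pos: "0 < Im (F z) \<longleftrightarrow> 0 < Im z"
proof -
  have *: "0 < Im (F z)" if "0 < Im z" for z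
  proof -
    obtain t where "0 < t" "t < Im (F (\<i> * of_real t))" by (rule F_small)
    then show ?thesis
      using that by (intro pos_on_connected[of "{z. 0 < Im z}" "\<lambda>z. Im (F z)" "\<i> * of_real t" z]
          continuous_intros continuous_F convex_connected[OF convex_halfspace_Im_gt])
        (auto simp: Im_F_eq_0)
  qed
  show ?thesis using *[of z] *[of "- z"] Im_F_eq_0[of z] by (fastforce simp: minus)
qed

lemma G_pos: "0 < Re (G z) \<longleftrightarrow> 0 < Re z" "0 < Im (G z) \<longleftrightarrow> 0 < Im z"
  "Re (G z) = 0 \<longleftrightarrow> Re z = 0" "Im (G z) = 0 \<longleftrightarrow> Im z = 0"
  using Re_F_pos[of "G z"] Im_F_pos[of "G z"] Re_F_eq_0[of "G z"] Im_F_eq_0[of "G z"] by auto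

lemma fixed_G: "G z = z \<Longrightarrow> z = 0"
  using fixed[of z] FG(1)[of z] by metis

text \<open>\<open>F\<close> acts on the positive half-axis as a one-dimensional map without fixed
  points that moves one point inwards; oddness covers the other half.\<close>

lemma real_axis_stable:
  assumes "Im z = 0"
  shows "(\<lambda>n. (F ^^ n) z) \<longlonglongrightarrow> 0"
proof -
  define \<phi> where "\<phi> x = Re (F (of_real x))" for x
  have F_real: "F (of_real x) = of_real (\<phi> x)" for x
    using Im_F_eq_0[of "of_real x"] by (simp add: \<phi>_def complex_eq_iff)
  have pow: "(F ^^ n) (of_real x) = of_real ((\<phi> ^^ n) x)" for n x
    by (induction n) (simp_all add: F_real)
  obtain t where t: "0 < t" "\<phi> t < t" unfolding \<phi>_def by (rule F_small)
  have pos: "(\<lambda>n. (F ^^ n) (of_real x)) \<longlonglongrightarrow> 0" if x: "0 < x" for x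
  proof -
    have "(\<lambda>n. (\<phi> ^^ n) x) \<longlonglongrightarrow> 0"
    proof (rule funpow_tendsto_0[where \<phi> = \<phi>, OF _ _ _ t x])
      show "continuous_on UNIV \<phi>"
        unfolding \<phi>_def by (intro continuous_intros continuous_on_compose2[OF continuous_F[of UNIV]]) auto
      show "0 < \<phi> x" if "0 < x" for x using that by (simp add: \<phi>_def Re_F_pos)
      show "\<phi> x \<noteq> x" if "0 < x" for x using that fixed[of "of_real x"] by (auto simp: F_real)
    qed
    then show ?thesis unfolding pow by (metis of_real_0 tendsto_of_real)
  qed
  consider "z = 0" | "0 < Re z" | "0 < Re (- z)"
    using assms by (cases "Re z" "0 :: real" rule: linorder_cases) (auto simp: complex_eq_iff)
  then show ?thesis
  proof cases
    case 1
    have "(F ^^ n) 0 = 0" for n by (induction n) simp_all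
    then show ?thesis using 1 by simp
  next
    case 2
    have "z = of_real (Re z)" using assms by (simp add: complex_eq_iff)
    then show ?thesis using pos[OF 2] by simp
  next
    case 3
    have "- z = of_real (Re (- z))" using assms by (simp add: complex_eq_iff)
    then have "(\<lambda>n. (F ^^ n) (- z)) \<longlonglongrightarrow> 0" using pos[OF 3] by simp
    then show ?thesis
      using tendsto_minus[of "\<lambda>n. (F ^^ n) (- z)" 0] by (simp add: funpow_commute[of F uminus, OF minus])
  qed
qed

lemma imaginary_axis_unstable:
  assumes "Re z = 0"
  shows "(\<lambda>n. (G ^^ n) z) \<longlonglongrightarrow> 0"
proof -
  define \<phi> where "\<phi> y = Im (G (\<i> * of_real y))" for y
  have G_imag: "G (\<i> * of_real y) = \<i> * of_real (\<phi> y)" for y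
    using G_pos(3)[of "\<i> * of_real y"] by (simp add: \<phi>_def complex_eq_iff)
  have pow: "(G ^^ n) (\<i> * of_real y) = \<i> * of_real ((\<phi> ^^ n) y)" for n y
    by (induction n) (simp_all add: G_imag)
  obtain t where t: "0 < t" "t < Im (F (\<i> * of_real t))" by (rule F_small)
  \<comment> \<open>The height of the image under \<open>F\<close> of the small point at height
    \<open>t\<close>; \<open>G\<close> moves it back inwards to \<open>t\<close>.\<close>
  define a where "a = Im (F (\<i> * of_real t))"
  have "F (\<i> * of_real t) = \<i> * of_real a"
    using Re_F_eq_0[of "\<i> * of_real t"] by (simp add: a_def complex_eq_iff)
  then have "G (\<i> * of_real a) = \<i> * of_real t" by (metis FG(2))
  then have a: "0 < a" "\<phi> a < a" using t by (simp_all add: \<phi>_def a_def)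
  have pos: "(\<lambda>n. (G ^^ n) (\<i> * of_real y)) \<longlonglongrightarrow> 0" if y: "0 < y" for y
  proof -
    have "(\<lambda>n. (\<phi> ^^ n) y) \<longlonglongrightarrow> 0"
    proof (rule funpow_tendsto_0[where \<phi> = \<phi>, OF _ _ _ a y])
      show "continuous_on UNIV \<phi>"
        unfolding \<phi>_def by (intro continuous_intros continuous_on_compose2[OF continuous_G[of UNIV]]) auto
      show "0 < \<phi> x" if "0 < x" for x using that by (simp add: \<phi>_def G_pos)
      show "\<phi> x \<noteq> x" if "0 < x" for x using that fixed_G[of "\<i> * of_real x"] by (auto simp: G_imag)
    qed
    then have "(\<lambda>n. \<i> * of_real ((\<phi> ^^ n) y)) \<longlonglongrightarrow> \<i> * of_real 0"
      by (intro tendsto_intros)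
    then show ?thesis unfolding pow by simp
  qed
  consider "z = 0" | "0 < Im z" | "0 < Im (- z)"
    using assms by (cases "Im z" "0 :: real" rule: linorder_cases) (auto simp: complex_eq_iff)
  then show ?thesis
  proof cases
    case 1
    have "G 0 = 0" using FG(2)[of 0] by simp
    then have "(G ^^ n) 0 = 0" for n by (induction n) simp_all
    then show ?thesis using 1 by simp
  next
    case 2
    have "z = \<i> * of_real (Im z)" using assms by (simp add: complex_eq_iff)
    then show ?thesis using pos[OF 2] by simp
  next
    case 3
    have "- z = \<i> * of_real (Im (- z))" using assms by (simp add: complex_eq_iff)
    then have "(\<lambda>n. (G ^^ n) (- z)) \<longlonglongrightarrow> 0" using pos[OF 3] by simp
    then show ?thesis
      using tendsto_minus[of "\<lambda>n. (G ^^ n) (- z)" 0] by (simp add: funpow_commute[of G uminus, OF G_sym(2)])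
  qed
qed

text \<open>
  The mean value theorem replaces the local stable manifold theorem here, because both axes are
  already invariant.
\<close>
lemma local_expansion:
  obtains r where "0 < r"
    "\<And>z. \<lbrakk>norm z < r; 0 < Im z\<rbrakk> \<Longrightarrow> Im z \<le> Im (F z)"
    "\<And>z. \<lbrakk>norm z < r; 0 < Re z\<rbrakk> \<Longrightarrow> Re (F z) \<le> Re z"
proof -
  have "((\<lambda>z. Im (F' z \<i>)) \<longlongrightarrow> m) (at 0)" "((\<lambda>z. Re (F' z 1)) \<longlongrightarrow> l) (at 0)"
    using deriv_cont[of \<i>] deriv_cont[of 1] tendsto_Im tendsto_Re
    by (fastforce simp: isCont_def deriv_0)+
  then have "\<forall>\<^sub>F z in at 0. 1 < Im (F' z \<i>)" "\<forall>\<^sub>F z in at 0. Re (F' z 1) < 1"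
    using lm by (auto intro: order_tendstoD)
  then obtain r1 r2 where r: "0 < r1" "0 < r2"
      "\<And>z. \<lbrakk>norm z < r1; z \<noteq> 0\<rbrakk> \<Longrightarrow> 1 < Im (F' z \<i>)"
      "\<And>z. \<lbrakk>norm z < r2; z \<noteq> 0\<rbrakk> \<Longrightarrow> Re (F' z 1) < 1"
    by (auto simp: eventually_at)
  have "Im z \<le> Im (F z)" if z: "norm z < min r1 r2" "0 < Im z" for z
  proof -
    \<comment> \<open>The vertical segment starts on the real axis, where \<open>Im (F z)\<close> is
      0, and \<open>?g\<close> is nondecreasing since the vertical derivative is at least 1.\<close>
    let ?g = "\<lambda>t. Im (F (of_real (Re z) + of_real t * \<i>)) - t"
    have "?g 0 \<le> ?g (Im z)"
    proof (rule DERIV_nonneg_imp_nondecreasing[where f = ?g])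
      fix t assume t: "0 \<le> t" "t \<le> Im z"
      let ?w = "of_real (Re z) + of_real t * \<i>"
      have "norm ?w \<le> norm z" using t by (simp add: cmod_def power_mono)
      then have "1 \<le> Im (F' ?w \<i>)"
        using r(3)[of ?w] z(1) deriv_0[of \<i>] lm by (cases "?w = 0") auto
      then show "\<exists>d. (?g has_real_derivative d) (at t) \<and> 0 \<le> d"
        by (intro exI[of _ "Im (F' ?w \<i>) - 1"] conjI derivative_intros DERIV_Im) auto
    qed (use z in simp)
    moreover have "of_real (Re z) + of_real (Im z) * \<i> = z" by (simp add: complex_eq_iff)
    moreover have "Im (F (of_real (Re z))) = 0" by (simp add: Im_F_eq_0)
    ultimately show ?thesis by simp
  qed
  moreover have "Re (F z) \<le> Re z" if z: "norm z < min r1 r2" "0 < Re z" for z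
  proof -
    let ?g = "\<lambda>t. t - Re (F (\<i> * of_real (Im z) + of_real t * 1))"
    have "?g 0 \<le> ?g (Re z)"
    proof (rule DERIV_nonneg_imp_nondecreasing[where f = ?g])
      fix t assume t: "0 \<le> t" "t \<le> Re z"
      let ?w = "\<i> * of_real (Im z) + of_real t * 1"
      have "norm ?w \<le> norm z" using t by (simp add: cmod_def power_mono)
      then have "Re (F' ?w 1) \<le> 1"
        using r(4)[of ?w] z(1) deriv_0[of 1] lm by (cases "?w = 0") auto
      then show "\<exists>d. (?g has_real_derivative d) (at t) \<and> 0 \<le> d"
        by (intro exI[of _ "1 - Re (F' ?w 1)"] conjI derivative_intros DERIV_Re) auto
    qed (use z in simp)
    moreover have "\<i> * of_real (Im z) + of_real (Re z) * 1 = z" by (simp add: complex_eq_iff)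
    moreover have "Re (F (\<i> * of_real (Im z))) = 0" by (simp add: Re_F_eq_0)
    ultimately show ?thesis by simp
  qed
  ultimately show ?thesis using that[of "min r1 r2"] r(1,2) by auto
qed

text \<open>Near 0 the map \<open>F\<close> does not decrease a positive imaginary part, so an orbit
  that stays there keeps away from the real axis.\<close>

lemma not_stable:
  assumes "Im z \<noteq> 0"
  shows "\<not> (\<lambda>n. (F ^^ n) z) \<longlonglongrightarrow> 0"
proof -
  have *: False if z: "0 < Im z" and lim: "(\<lambda>n. (F ^^ n) z) \<longlonglongrightarrow> 0" for z
  proof -
    have pos: "0 < Im ((F ^^ n) z)" for n by (induction n) (simp_all add: z Im_F_pos)
    obtain r where r: "0 < r" "\<And>z. \<lbrakk>norm z < r; 0 < Im z\<rbrakk> \<Longrightarrow> Im z \<le> Im (F z)"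
      by (rule local_expansion) blast
    obtain N where N: "\<And>n. N \<le> n \<Longrightarrow> norm ((F ^^ n) z) < r"
      using LIMSEQ_D[OF lim r(1)] by auto
    have "Im ((F ^^ N) z) \<le> Im ((F ^^ n) z)" if "N \<le> n" for n
      using that
    proof (induction n rule: dec_induct)
      case (step n)
      then show ?case using r(2)[of "(F ^^ n) z"] N[of n] pos[of n] by simp
    qed simp
    moreover have "(\<lambda>n. Im ((F ^^ n) z)) \<longlonglongrightarrow> 0" using tendsto_Im[OF lim] by simp
    ultimately have "Im ((F ^^ N) z) \<le> 0" by (intro LIMSEQ_le_const) auto
    then show False using pos[of N] by simp
  qed
  show ?thesis
  proof
    assume lim: "(\<lambda>n. (F ^^ n) z) \<longlonglongrightarrow> 0"
    then have "(\<lambda>n. (F ^^ n) (- z)) \<longlonglongrightarrow> 0"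
      using tendsto_minus[OF lim] by (simp add: funpow_commute[of F uminus, OF minus])
    then show False using *[OF _ lim] *[of "- z"] assms by force
  qed
qed

lemma not_unstable:
  assumes "Re z \<noteq> 0"
  shows "\<not> (\<lambda>n. (G ^^ n) z) \<longlonglongrightarrow> 0"
proof -
  have *: False if z: "0 < Re z" and lim: "(\<lambda>n. (G ^^ n) z) \<longlonglongrightarrow> 0" for z
  proof -
    have pos: "0 < Re ((G ^^ n) z)" for n by (induction n) (simp_all add: z G_pos)
    obtain r where r: "0 < r" "\<And>z. \<lbrakk>norm z < r; 0 < Re z\<rbrakk> \<Longrightarrow> Re (F z) \<le> Re z"
      by (rule local_expansion) blast
    obtain N where N: "\<And>n. N \<le> n \<Longrightarrow> norm ((G ^^ n) z) < r"
      using LIMSEQ_D[OF lim r(1)] by auto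
    have "Re ((G ^^ N) z) \<le> Re ((G ^^ n) z)" if "N \<le> n" for n
      using that
    proof (induction n rule: dec_induct)
      case (step n)
      \<comment> \<open>The bound on \<open>F\<close> is applied at the later backward point, whose
        image is the earlier one.\<close>
      then show ?case using r(2)[of "(G ^^ Suc n) z"] N[of "Suc n"] pos[of "Suc n"] by simp
    qed simp
    moreover have "(\<lambda>n. Re ((G ^^ n) z)) \<longlonglongrightarrow> 0" using tendsto_Re[OF lim] by simp
    ultimately have "Re ((G ^^ N) z) \<le> 0" by (intro LIMSEQ_le_const) auto
    then show False using pos[of N] by simp
  qed
  show ?thesis
  proof
    assume lim: "(\<lambda>n. (G ^^ n) z) \<longlonglongrightarrow> 0"
    then have "(\<lambda>n. (G ^^ n) (- z)) \<longlonglongrightarrow> 0"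
      using tendsto_minus[OF lim] by (simp add: funpow_commute[of G uminus, OF G_sym(2)])
    then show False using *[OF _ lim] *[of "- z"] assms by force
  qed
qed

section \<open>Stable and unstable sets, escape to infinity\<close>

lemma stable_iff: "(\<lambda>n. (F ^^ n) z) \<longlonglongrightarrow> 0 \<longleftrightarrow> Im z = 0"
  using real_axis_stable not_stable by blast

lemma unstable_iff: "(\<lambda>n. (G ^^ n) z) \<longlonglongrightarrow> 0 \<longleftrightarrow> Re z = 0"
  using imaginary_axis_unstable not_unstable by blast

text \<open>The pair logarithm comes from the derivative at 0: the real part of
  \<open>F' 0 v / v\<close> is
  \<open>(l * (Re v)\<^sup>2 + m * (Im v)\<^sup>2) / (norm v)\<^sup>2\<close>, which is
  positive.\<close>

lemma free_homeo_quadrant: "free_homeo quadrant F"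
proof -
  have "F z \<in> quadrant \<longleftrightarrow> z \<in> quadrant" for z by (simp add: quadrant_def Re_F_pos Im_F_pos)
  then have "F ` quadrant = quadrant" by (metis FG(1) image_eqI image_subsetI subsetI subset_antisym)
  moreover have "has_pair_log F"
  proof (rule has_pair_log_derivative[OF continuous_F _ deriv])
    show "inj F" by (simp add: inj_def F_eq_iff)
    fix v :: complex assume "v \<noteq> 0"
    then have "0 < l * (Re v)\<^sup>2 + m * (Im v)\<^sup>2" "0 < (Re v)\<^sup>2 + (Im v)\<^sup>2"
      using lm by (auto simp: complex_eq_iff intro: add_pos_nonneg add_nonneg_pos)
    then show "0 < Re (F' 0 v / v)"
      by (simp add: deriv_0 Re_divide power2_eq_square algebra_simps)
  qed
  moreover have "F z \<noteq> z" if "z \<in> quadrant" for z using fixed[of z] that by (auto simp: quadrant_def)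
  ultimately show ?thesis using homeo unfolding free_homeo_def by blast
qed

text \<open>A ball disjoint from its image meets the quadrant in a free convex open set. Taking only
  this trace allows \<open>q\<close> to lie on an axis.\<close>

lemma visits_once:
  assumes "q \<noteq> 0"
  obtains e where "0 < e" "\<And>p n. \<lbrakk>p \<in> quadrant; p \<in> ball q e; 0 < n\<rbrakk> \<Longrightarrow> (F ^^ n) p \<notin> ball q e"
proof -
  define d where "d = dist q (F q) / 2"
  have "0 < d" using fixed[of q] assms by (auto simp: d_def)
  moreover have "isCont F q" using continuous_F[of UNIV] by (simp add: continuous_on_eq_continuous_at)
  ultimately obtain e0 where e0: "0 < e0" "\<And>z. dist z q < e0 \<Longrightarrow> dist (F z) (F q) < d"
    unfolding continuous_at_eps_delta by metis
  define e where "e = min e0 d"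
  have "0 < e" using e0 \<open>0 < d\<close> by (simp add: e_def)
  have free: "F z \<notin> ball q e" if "z \<in> ball q e" for z
  proof
    assume "F z \<in> ball q e"
    then have "dist q (F z) < d" "dist (F z) (F q) < d" using that e0(2)[of z] by (auto simp: e_def dist_commute)
    then show False using dist_triangle[of q "F q" "F z"] by (simp add: d_def)
  qed
  have "(F ^^ n) p \<notin> ball q e" if p: "p \<in> quadrant" "p \<in> ball q e" "0 < n" for p n
  proof -
    have "(F ^^ n) p \<notin> ball q e \<inter> quadrant"
    proof (rule no_return[OF free_homeo_quadrant])
      show "connected (ball q e \<inter> quadrant)"
        by (intro convex_connected convex_Int convex_ball convex_quadrant)
    qed (use p free open_quadrant in auto)
    then show ?thesis using free_homeo_funpow_in[OF free_homeo_quadrant p(1)] by blast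
  qed
  then show ?thesis using that \<open>0 < e\<close> by blast
qed

text \<open>At most one visit to a small ball around each \<open>q \<noteq> 0\<close> leaves only
  convergence to 0 or escape, and the former contradicts \<open>not_stable\<close> or
  \<open>not_unstable\<close>.\<close>

lemma quadrant_escape:
  assumes p: "p \<in> quadrant"
  shows "filterlim (\<lambda>n. norm ((F ^^ n) p)) at_top sequentially"
    and "filterlim (\<lambda>n. norm ((G ^^ n) p)) at_top sequentially"
proof -
  have Gq: "(G ^^ n) p \<in> quadrant" for n
    using p by (induction n) (auto simp: quadrant_def G_pos)
  have Fq: "(F ^^ n) p \<in> quadrant" for n using free_homeo_funpow_in[OF free_homeo_quadrant p] .
  have "(\<lambda>n. (F ^^ n) p) \<longlonglongrightarrow> 0 \<or> filterlim (\<lambda>n. norm ((F ^^ n) p)) at_top sequentially"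
  proof (rule tendsto_0_or_at_top[where f = F])
    show "isCont F 0" using continuous_F[of UNIV] by (simp add: continuous_on_eq_continuous_at)
    fix q :: complex assume "q \<noteq> 0"
    then obtain e where e: "0 < e" "\<And>p n. \<lbrakk>p \<in> quadrant; p \<in> ball q e; 0 < n\<rbrakk> \<Longrightarrow> (F ^^ n) p \<notin> ball q e"
      using visits_once by metis
    have "finite {n. (F ^^ n) p \<in> ball q e}"
    proof (rule finite_at_most_one)
      fix i j assume ij: "i \<in> {n. (F ^^ n) p \<in> ball q e}" "j \<in> {n. (F ^^ n) p \<in> ball q e}" "i < j"
      have "(F ^^ j) p = (F ^^ (j - i)) ((F ^^ i) p)" using ij(3) by (simp flip: funpow_add[THEN fun_cong, simplified])
      then show False using e(2)[OF Fq[of i], of "j - i"] ij by simp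
    qed
    then show "\<exists>e>0. finite {n. (F ^^ n) p \<in> ball q e}" using e(1) by blast
  qed simp_all
  moreover have "Im p \<noteq> 0" "Re p \<noteq> 0" using p by (auto simp: quadrant_def)
  ultimately show "filterlim (\<lambda>n. norm ((F ^^ n) p)) at_top sequentially" using not_stable by blast
  have "(\<lambda>n. (G ^^ n) p) \<longlonglongrightarrow> 0 \<or> filterlim (\<lambda>n. norm ((G ^^ n) p)) at_top sequentially"
  proof (rule tendsto_0_or_at_top[where f = G])
    show "isCont G 0" using continuous_G[of UNIV] by (simp add: continuous_on_eq_continuous_at)
    show "G 0 = 0" using FG(2)[of 0] by simp
    fix q :: complex assume "q \<noteq> 0"
    then obtain e where e: "0 < e" "\<And>p n. \<lbrakk>p \<in> quadrant; p \<in> ball q e; 0 < n\<rbrakk> \<Longrightarrow> (F ^^ n) p \<notin> ball q e"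
      using visits_once by metis
    have "finite {n. (G ^^ n) p \<in> ball q e}"
    proof (rule finite_at_most_one)
      fix i j assume ij: "i \<in> {n. (G ^^ n) p \<in> ball q e}" "j \<in> {n. (G ^^ n) p \<in> ball q e}" "i < j"
      \<comment> \<open>Two visits of the backward orbit, read forwards, are a return under
        \<open>F\<close>.\<close>
      have "(F ^^ (j - i)) ((G ^^ j) p) = (G ^^ i) p" using ij(3) by (intro funpow_cancel) auto
      then show False using e(2)[OF Gq[of j], of "j - i"] ij by simp
    qed
    then show "\<exists>e>0. finite {n. (G ^^ n) p \<in> ball q e}" using e(1) by blast
  qed simp_all
  then show "filterlim (\<lambda>n. norm ((G ^^ n) p)) at_top sequentially"
    using not_unstable \<open>Re p \<noteq> 0\<close> by blast
qed

lemma escape: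
  assumes z: "Re z \<noteq> 0" "Im z \<noteq> 0"
  shows "filterlim (\<lambda>n. norm ((F ^^ n) z)) at_top sequentially"
    and "filterlim (\<lambda>n. norm ((G ^^ n) z)) at_top sequentially"
proof -
  have norm: "norm ((F ^^ n) (- w)) = norm ((F ^^ n) w)" "norm ((F ^^ n) (cnj w)) = norm ((F ^^ n) w)"
    "norm ((G ^^ n) (- w)) = norm ((G ^^ n) w)" "norm ((G ^^ n) (cnj w)) = norm ((G ^^ n) w)" for n w
    by (simp_all add: funpow_commute[of F uminus] funpow_commute[of F cnj] cnj minus
        funpow_commute[of G uminus] funpow_commute[of G cnj] G_sym)
  consider "z \<in> quadrant" | "cnj z \<in> quadrant" | "- z \<in> quadrant" | "cnj (- z) \<in> quadrant"
    using z by (fastforce simp: quadrant_def linorder_neq_iff)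
  then have "filterlim (\<lambda>n. norm ((F ^^ n) z)) at_top sequentially \<and>
    filterlim (\<lambda>n. norm ((G ^^ n) z)) at_top sequentially"
  proof cases
    case 1
    then show ?thesis using quadrant_escape by blast
  next
    case 2
    from quadrant_escape[OF this] show ?thesis by (simp add: norm)
  next
    case 3
    from quadrant_escape[OF this] show ?thesis by (simp add: norm)
  next
    case 4
    from quadrant_escape[OF this] show ?thesis unfolding norm by blast
  qed
  then show "filterlim (\<lambda>n. norm ((F ^^ n) z)) at_top sequentially"
    "filterlim (\<lambda>n. norm ((G ^^ n) z)) at_top sequentially" by blast+
qed

end

section \<open>Transfer to the plane\<close>

locale orthonormal_frame =
  fixes a b :: "real^2"
  assumes norm_a: "norm a = 1" and norm_b: "norm b = 1" and ab: "a \<bullet> b = 0"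
begin

lemma inner_frame [simp]: "a \<bullet> a = 1" "b \<bullet> b = 1" "a \<bullet> b = 0" "b \<bullet> a = 0"
  using norm_a norm_b ab by (simp_all add: dot_square_norm inner_commute)

lemma expand: "(x \<bullet> a) *\<^sub>R a + (x \<bullet> b) *\<^sub>R b = x"
proof -
  have "a \<noteq> b" "a \<noteq> 0" "b \<noteq> 0" using inner_frame by force+
  have "independent {a, b}"
    using \<open>a \<noteq> 0\<close> \<open>b \<noteq> 0\<close>
    by (intro pairwise_orthogonal_independent) (auto simp: pairwise_def orthogonal_def)
  then have span: "UNIV \<subseteq> span {a, b}"
    using \<open>a \<noteq> b\<close> by (intro card_ge_dim_independent) (auto simp: dim_UNIV)
  \<comment> \<open>The defect is orthogonal to two vectors that span the plane, hence to
    itself.\<close>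
  define y where "y = x - (x \<bullet> a) *\<^sub>R a - (x \<bullet> b) *\<^sub>R b"
  have "y \<bullet> a = 0" "y \<bullet> b = 0" by (simp_all add: y_def inner_diff_left)
  moreover obtain s t where "y = s *\<^sub>R a + t *\<^sub>R b"
    using span by (fastforce simp: span_breakdown_eq span_singleton algebra_simps)
  ultimately have "y \<bullet> y = 0" by (metis add.right_neutral inner_add_right inner_scaleR_right mult_zero_right)
  then have "y = 0" by simp
  then show ?thesis by (simp add: y_def algebra_simps)
qed

definition \<psi> :: "complex \<Rightarrow> real^2" where
  "\<psi> z = Re z *\<^sub>R a + Im z *\<^sub>R b"

definition \<psi>' :: "real^2 \<Rightarrow> complex" where
  "\<psi>' x = Complex (x \<bullet> a) (x \<bullet> b)"

lemma \<psi>_inverse [simp]: "\<psi>' (\<psi> z) = z" "\<psi> (\<psi>' x) = x"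
  by (simp_all add: \<psi>_def \<psi>'_def complex_eq_iff inner_add_left expand)

lemma \<psi>'_sel [simp]: "Re (\<psi>' x) = x \<bullet> a" "Im (\<psi>' x) = x \<bullet> b"
  by (simp_all add: \<psi>'_def)

lemma bounded_linear_\<psi>: "bounded_linear \<psi>"
  unfolding \<psi>_def
  by (intro bounded_linear_add bounded_linear_scaleR_left[THEN bounded_linear_compose]
      bounded_linear_Re bounded_linear_Im)

lemma bounded_linear_\<psi>': "bounded_linear \<psi>'"
proof -
  have "\<psi>' = (\<lambda>x. complex_of_real (x \<bullet> a) + \<i> * complex_of_real (x \<bullet> b))"
    by (simp add: \<psi>'_def fun_eq_iff complex_eq_iff)
  then show ?thesis
    by (auto intro!: bounded_linear_add bounded_linear_const_mult bounded_linear_of_real[THEN bounded_linear_compose]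
        bounded_linear_inner_left)
qed

lemma norm_\<psi>: "norm (\<psi> z) = norm z"
proof -
  have "\<psi> z \<bullet> \<psi> z = (Re z)\<^sup>2 + (Im z)\<^sup>2"
    by (simp add: \<psi>_def inner_add_left inner_add_right power2_eq_square)
  then show ?thesis unfolding norm_eq_sqrt_inner[of "\<psi> z"] cmod_def by simp
qed

lemma tendsto_\<psi>_iff: "(\<lambda>n. \<psi> (X n)) \<longlonglongrightarrow> 0 \<longleftrightarrow> X \<longlonglongrightarrow> 0"
  using tendsto_norm_zero_iff[of "\<lambda>n. \<psi> (X n)" sequentially] tendsto_norm_zero_iff[of X sequentially]
  by (simp add: norm_\<psi>)

text \<open>The coordinate of any parametrisation along \<open>a\<close> is a continuous bijection
  of the real line, so it leaves every bounded set at both ends.\<close>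

lemma curve_limit_set_line: "curve_limit_set {x. x \<bullet> b = 0} = {}"
proof -
  have "branch_limit_pos \<tau> = {} \<and> branch_limit_neg \<tau> = {}" if \<tau>: "curve_param \<tau> {x. x \<bullet> b = 0}" for \<tau>
  proof -
    define r where "r t = \<tau> t \<bullet> a" for t
    have cont: "continuous_on A r" for A
      using \<tau> continuous_on_subset[of UNIV \<tau> A]
      by (auto simp: r_def curve_param_def intro!: continuous_intros)
    have on_line: "\<tau> t \<bullet> b = 0" for t using \<tau> by (auto simp: curve_param_def)
    have \<tau>r: "\<tau> t = r t *\<^sub>R a" for t using expand[of "\<tau> t"] on_line[of t] by (simp add: r_def)
    have surj: "\<exists>t. r t = w" for w
    proof -
      have "w *\<^sub>R a \<in> range \<tau>" using \<tau> by (simp add: curve_param_def)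
      then obtain t where "\<tau> t = w *\<^sub>R a" by force
      then have "r t = w" by (simp add: r_def)
      then show ?thesis by blast
    qed
    have bound: "\<exists>T>0. \<forall>t. T \<le> \<bar>t\<bar> \<longrightarrow> M \<le> \<bar>r t\<bar>" if "0 \<le> M" for M
    proof -
      \<comment> \<open>Between \<open>t1\<close> and \<open>t2\<close> the coordinate takes every
        value of modulus below \<open>M\<close>; by injectivity no such value occurs
        elsewhere.\<close>
      obtain t1 t2 where t12: "r t1 = - M" "r t2 = M" using surj by metis
      define I where "I = closed_segment t1 t2"
      have I: "connected (r ` I)" unfolding I_def
        by (intro connected_continuous_image cont) auto
      have "M \<le> \<bar>r t\<bar>" if t: "\<bar>t1\<bar> + \<bar>t2\<bar> + 1 \<le> \<bar>t\<bar>" for t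
      proof (rule ccontr)
        assume "\<not> M \<le> \<bar>r t\<bar>"
        moreover have "r t1 \<in> r ` I" "r t2 \<in> r ` I" by (simp_all add: I_def)
        ultimately have "r t \<in> r ` I"
          using connectedD_interval[OF I, of "r t1" "r t2" "r t"] t12 by linarith
        then obtain s where s: "s \<in> I" "r s = r t" by auto
        then have "\<tau> s = \<tau> t" using \<tau>r by metis
        then have "s = t" using \<tau> by (auto simp: curve_param_def inj_eq)
        then show False using s(1) t by (auto simp: I_def closed_segment_eq_real_ivl split: if_splits)
      qed
      then show ?thesis by (intro exI[of _ "\<bar>t1\<bar> + \<bar>t2\<bar> + 1"]) auto
    qed
    have far: "\<exists>T>0. \<forall>A. (\<forall>t\<in>A. T \<le> \<bar>t\<bar>) \<longrightarrow> x \<notin> closure (\<tau> ` A)" for x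
    proof -
      obtain T where T: "0 < T" "\<And>t. T \<le> \<bar>t\<bar> \<Longrightarrow> \<bar>x \<bullet> a\<bar> + 1 \<le> \<bar>r t\<bar>"
        using bound[of "\<bar>x \<bullet> a\<bar> + 1"] by auto
      have "x \<notin> closure (\<tau> ` A)" if "\<forall>t\<in>A. T \<le> \<bar>t\<bar>" for A
      proof -
        have "closed {y. \<bar>x \<bullet> a\<bar> + 1 \<le> \<bar>y \<bullet> a\<bar>}"
          by (intro closed_Collect_le continuous_intros)
        then have "closure (\<tau> ` A) \<subseteq> {y. \<bar>x \<bullet> a\<bar> + 1 \<le> \<bar>y \<bullet> a\<bar>}"
          using T(2) that by (intro closure_minimal) (auto simp: r_def)
        then show ?thesis by auto
      qed
      then show ?thesis using T(1) by blast
    qed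
    have "x \<notin> branch_limit_pos \<tau>" for x
    proof -
      obtain T where T: "0 < T" "\<And>A. (\<forall>t\<in>A. T \<le> \<bar>t\<bar>) \<Longrightarrow> x \<notin> closure (\<tau> ` A)" using far[of x] by blast
      have "x \<notin> closure (\<tau> ` {T..})" by (rule T(2)) auto
      then show ?thesis using T(1) unfolding branch_limit_pos_def by force
    qed
    moreover have "x \<notin> branch_limit_neg \<tau>" for x
    proof -
      obtain T where T: "0 < T" "\<And>A. (\<forall>t\<in>A. T \<le> \<bar>t\<bar>) \<Longrightarrow> x \<notin> closure (\<tau> ` A)" using far[of x] by blast
      have "x \<notin> closure (\<tau> ` {..- T})" by (rule T(2)) auto
      then show ?thesis using T(1) unfolding branch_limit_neg_def by force
    qed
    ultimately show ?thesis by blast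
  qed
  then show ?thesis by (auto simp: curve_limit_set_def)
qed

lemma curve_param_line: "curve_param (\<lambda>t. t *\<^sub>R a) {x. x \<bullet> b = 0}"
proof -
  have "a \<noteq> 0" using norm_a by auto
  moreover have "x \<in> range (\<lambda>t. t *\<^sub>R a)" if "x \<bullet> b = 0" for x
    using expand[of x] that by (intro range_eqI[of _ _ "x \<bullet> a"]) simp
  ultimately show ?thesis
    by (auto simp: curve_param_def inj_def intro!: continuous_intros)
qed

lemma unbounded_line: "\<not> bounded {x. x \<bullet> b = 0}"
proof
  assume "bounded {x. x \<bullet> b = 0}"
  then obtain B where B: "\<And>x. x \<bullet> b = 0 \<Longrightarrow> norm x \<le> B" by (auto simp: bounded_iff)
  show False using B[of "(\<bar>B\<bar> + 1) *\<^sub>R a"] norm_a by simp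
qed

text \<open>The pair of signs \<open>p\<close> selects one of the four open quadrants of the frame.\<close>
definition sector :: "real \<times> real \<Rightarrow> (real^2) set" where
  "sector p = {x. 0 < fst p * (x \<bullet> a) \<and> 0 < snd p * (x \<bullet> b)}"

text \<open>A sector is convex, and on a connected set off the axes neither coordinate changes
  sign.\<close>

lemma components_sectors:
  "components {x. x \<bullet> a \<noteq> 0 \<and> x \<bullet> b \<noteq> 0} = sector ` ({1, -1} \<times> {1, -1})" (is "components ?S = _")
proof -
  have comp: "connected_component_set ?S x = sector p" if x: "x \<in> sector p" for x p
  proof (rule connected_component_unique)
    show "sector p \<subseteq> ?S" by (auto simp: sector_def)
    have eq: "sector p = {x. (fst p *\<^sub>R a) \<bullet> x > 0} \<inter> {x. (snd p *\<^sub>R b) \<bullet> x > 0}"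
      by (auto simp: sector_def inner_commute)
    show "connected (sector p)"
      unfolding eq by (intro convex_connected convex_Int convex_halfspace_gt)
    fix C assume C: "x \<in> C" "C \<subseteq> ?S" "connected C"
    show "C \<subseteq> sector p"
    proof
      fix y assume "y \<in> C"
      have "0 < fst p * (y \<bullet> a)"
        by (rule pos_on_connected[OF C(3) _ _ C(1) _ \<open>y \<in> C\<close>])
          (use x C(2) in \<open>auto simp: sector_def intro!: continuous_intros\<close>)
      moreover have "0 < snd p * (y \<bullet> b)"
        by (rule pos_on_connected[OF C(3) _ _ C(1) _ \<open>y \<in> C\<close>])
          (use x C(2) in \<open>auto simp: sector_def intro!: continuous_intros\<close>)
      ultimately show "y \<in> sector p" by (simp add: sector_def)
    qed
  qed (rule x)
  have fwd: "x \<in> sector (sgn (x \<bullet> a), sgn (x \<bullet> b)) \<and> (sgn (x \<bullet> a), sgn (x \<bullet> b)) \<in> {1, -1} \<times> {1, -1}"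
    if "x \<in> ?S" for x
    using that by (auto simp: sector_def sgn_if)
  have bwd: "fst p *\<^sub>R a + snd p *\<^sub>R b \<in> sector p \<inter> ?S" if "p \<in> {1, -1} \<times> {1, -1}" for p
    using that by (auto simp: sector_def inner_add_left)
  show ?thesis unfolding components_def
  proof (intro equalityI image_subsetI)
    fix x assume "x \<in> ?S"
    note x = fwd[OF this]
    show "connected_component_set ?S x \<in> sector ` ({1, -1} \<times> {1, -1})"
      unfolding comp[OF conjunct1[OF x]] by (rule imageI[OF conjunct2[OF x]])
  next
    fix p :: "real \<times> real" assume "p \<in> {1, -1} \<times> {1, -1}"
    note x = bwd[OF this]
    show "sector p \<in> connected_component_set ?S ` ?S"
      unfolding comp[OF IntD1[OF x], symmetric] by (rule imageI[OF IntD2[OF x]])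
  qed
qed

lemma card_sectors: "card (sector ` ({1, -1} \<times> {1, -1})) = 4"
proof -
  have "inj_on sector ({1, -1} \<times> {1, -1})"
  proof (rule inj_onI)
    fix p q assume pq: "p \<in> {1, -1} \<times> {1, - 1}" "q \<in> {1, -1} \<times> {1, -1}" "sector p = sector q"
    have "fst p *\<^sub>R a + snd p *\<^sub>R b \<in> sector p" using pq(1) by (auto simp: sector_def inner_add_left)
    then have "fst p *\<^sub>R a + snd p *\<^sub>R b \<in> sector q" using pq(3) by simp
    then show "p = q" using pq(1,2) by (auto simp: sector_def inner_add_left)
  qed
  then show ?thesis by (simp add: card_image card_cartesian_product)
qed

end

text \<open>\<open>a\<close> spans the contracting axis and \<open>b\<close> the expanding
  one.\<close>

locale D2_saddle = orthonormal_frame +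
  fixes f :: "real^2 \<Rightarrow> real^2" and f' :: "real^2 \<Rightarrow> (real^2) \<Rightarrow>\<^sub>L (real^2)" and l m :: real
  assumes homeo_f: "homeomorphism UNIV UNIV f (inv_into UNIV f)"
    and deriv_f: "(f has_derivative blinfun_apply (f' x)) (at x)" and cont_f': "continuous_on UNIV f'"
    and reflect_a: "f ((2 * (a \<bullet> x)) *\<^sub>R a - x) = (2 * (a \<bullet> f x)) *\<^sub>R a - f x"
    and reflect_b: "f ((2 * (b \<bullet> x)) *\<^sub>R b - x) = (2 * (b \<bullet> f x)) *\<^sub>R b - f x"
    and fixed_f: "f x = x \<Longrightarrow> x = 0"
    and eigen: "f' 0 a = l *\<^sub>R a" "f' 0 b = m *\<^sub>R b"
    and lm_f: "0 < l" "l < 1" "1 < m"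
begin

section \<open>Conjugation with the complex plane\<close>

definition F :: "complex \<Rightarrow> complex" where
  "F = \<psi>' \<circ> f \<circ> \<psi>"

definition G :: "complex \<Rightarrow> complex" where
  "G = \<psi>' \<circ> inv_into UNIV f \<circ> \<psi>"

lemma \<psi>_conj: "\<psi> (cnj z) = (2 * (a \<bullet> \<psi> z)) *\<^sub>R a - \<psi> z" "\<psi> (- cnj z) = (2 * (b \<bullet> \<psi> z)) *\<^sub>R b - \<psi> z"
  by (simp_all add: \<psi>_def inner_add_right algebra_simps flip: scaleR_add_left)

lemma \<psi>F: "\<psi> (F z) = f (\<psi> z)" and \<psi>G: "\<psi> (G z) = inv_into UNIV f (\<psi> z)"
  by (simp_all add: F_def G_def)

lemma \<psi>_eq_iff: "\<psi> z = \<psi> w \<longleftrightarrow> z = w"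
  by (metis \<psi>_inverse(1))

sublocale symmetric_saddle F G "\<lambda>z v. \<psi>' (f' (\<psi> z) (\<psi> v))" l m
proof
  interpret \<psi>: bounded_linear \<psi> by (rule bounded_linear_\<psi>)
  interpret \<psi>': bounded_linear \<psi>' by (rule bounded_linear_\<psi>')
  have inv: "f (inv_into UNIV f x) = x" "inv_into UNIV f (f x) = x" for x
    using homeo_f by (auto simp: homeomorphism_def)
  have cont: "continuous_on UNIV f" "continuous_on UNIV (inv_into UNIV f)"
    using homeo_f by (auto simp: homeomorphism_def)
  show "homeomorphism UNIV UNIV F G"
    unfolding homeomorphism_def F_def G_def
    by (auto simp: inv o_def image_def intro!: continuous_on_compose2[OF cont(1)] continuous_on_compose2[OF cont(2)]
        \<psi>.continuous_on \<psi>'.continuous_on continuous_intros) (metis inv \<psi>_inverse)+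
  show "F (cnj z) = cnj (F z)" "F (- cnj z) = - cnj (F z)" for z
    using reflect_a[of "\<psi> z"] reflect_b[of "\<psi> z"]
    by (simp_all add: \<psi>_conj \<psi>F flip: \<psi>_eq_iff)
  show "z = 0" if "F z = z" for z
  proof -
    have "f (\<psi> z) = \<psi> z" using that \<psi>F[of z] by simp
    then have "\<psi> z = \<psi> 0" using fixed_f by (simp add: \<psi>.zero)
    then show ?thesis by (simp only: \<psi>_eq_iff)
  qed
  show "(F has_derivative (\<lambda>v. \<psi>' (f' (\<psi> z) (\<psi> v)))) (at z)" for z
    unfolding F_def
    using diff_chain_at[OF diff_chain_at[OF bounded_linear_imp_has_derivative[OF bounded_linear_\<psi>] deriv_f]
        bounded_linear_imp_has_derivative[OF bounded_linear_\<psi>'], of z]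
    by (simp add: o_def)
  have "continuous_on UNIV (\<lambda>z. \<psi>' (f' (\<psi> z) (\<psi> v)))" for v
    by (intro \<psi>'.continuous_on continuous_intros continuous_on_compose2[OF cont_f'] \<psi>.continuous_on) auto
  then show "isCont (\<lambda>z. \<psi>' (f' (\<psi> z) (\<psi> v))) 0" for v
    by (simp add: continuous_on_eq_continuous_at)
  show "\<psi>' (f' (\<psi> 0) (\<psi> v)) = Complex (l * Re v) (m * Im v)" for v
    unfolding \<psi>.zero
    by (simp add: \<psi>_def \<psi>'_def blinfun.bilinear_simps eigen inner_add_left)
qed (use lm_f in auto)

lemma pow: "(f ^^ n) (\<psi> z) = \<psi> ((F ^^ n) z)" "(inv_into UNIV f ^^ n) (\<psi> z) = \<psi> ((G ^^ n) z)"
  by (induction n) (simp_all add: \<psi>F \<psi>G)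

lemma Ws_eq: "Ws f = {x. x \<bullet> b = 0}"
proof -
  have "(\<lambda>n. (f ^^ n) x) \<longlonglongrightarrow> 0 \<longleftrightarrow> x \<bullet> b = 0" for x
  proof -
    have "(\<lambda>n. (f ^^ n) (\<psi> (\<psi>' x))) \<longlonglongrightarrow> 0 \<longleftrightarrow> Im (\<psi>' x) = 0"
      by (simp only: pow tendsto_\<psi>_iff stable_iff)
    then show ?thesis by simp
  qed
  then show ?thesis by (simp add: Ws_def)
qed

lemma Wu_eq: "Wu f = {x. x \<bullet> a = 0}"
proof -
  have "(\<lambda>n. (inv_into UNIV f ^^ n) x) \<longlonglongrightarrow> 0 \<longleftrightarrow> x \<bullet> a = 0" for x
  proof -
    have "(\<lambda>n. (inv_into UNIV f ^^ n) (\<psi> (\<psi>' x))) \<longlonglongrightarrow> 0 \<longleftrightarrow> Re (\<psi>' x) = 0"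
      by (simp only: pow tendsto_\<psi>_iff unstable_iff)
    then show ?thesis by simp
  qed
  then show ?thesis by (simp add: Wu_def Ws_def)
qed

lemma escape_f:
  assumes "x \<bullet> a \<noteq> 0" "x \<bullet> b \<noteq> 0"
  shows "filterlim (\<lambda>n. norm ((f ^^ n) x)) at_top sequentially"
    and "filterlim (\<lambda>n. norm ((inv_into UNIV f ^^ n) x)) at_top sequentially"
proof -
  have "norm ((f ^^ n) x) = norm ((F ^^ n) (\<psi>' x))"
    "norm ((inv_into UNIV f ^^ n) x) = norm ((G ^^ n) (\<psi>' x))" for n
    using pow[of n "\<psi>' x"] by (simp_all add: norm_\<psi>)
  then show "filterlim (\<lambda>n. norm ((f ^^ n) x)) at_top sequentially"
    "filterlim (\<lambda>n. norm ((inv_into UNIV f ^^ n) x)) at_top sequentially"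
    using escape[of "\<psi>' x"] assms by simp_all
qed

lemma sector_invariant:
  assumes "p \<in> {1, -1} \<times> {1, -1}"
  shows "f ` sector p = sector p"
proof -
  have *: "0 < fst p * Re (F z) \<longleftrightarrow> 0 < fst p * Re z" "0 < snd p * Im (F z) \<longleftrightarrow> 0 < snd p * Im z" for z
    using assms Re_F_pos[of z] Im_F_pos[of z] Re_F_pos[of "- z"] Im_F_pos[of "- z"]
    by (auto simp: minus)
  have "\<psi> z \<in> sector p \<longleftrightarrow> 0 < fst p * Re z \<and> 0 < snd p * Im z" for z
    by (simp add: sector_def \<psi>_def inner_add_left)
  then have "\<psi> (F z) \<in> sector p \<longleftrightarrow> \<psi> z \<in> sector p" for z
    by (simp only: *)
  then have iff: "f x \<in> sector p \<longleftrightarrow> x \<in> sector p" for x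
    by (metis \<psi>F \<psi>_inverse(2))
  moreover have "f (inv_into UNIV f x) = x" for x using homeo_f by (auto simp: homeomorphism_def)
  ultimately show ?thesis by (metis image_eqI image_subsetI subsetI subset_antisym)
qed

lemma f_0: "f 0 = 0"
  using \<psi>F[of 0] by (simp add: \<psi>_def)

text \<open>The two lines meet only at 0 and have no limit points at infinity; exchanging
  \<open>a\<close> and \<open>b\<close> treats the second line.\<close>

lemma no_contacts: "homoclinic_contacts f = {}"
proof -
  interpret swap: orthonormal_frame b a
    using norm_a norm_b ab by unfold_locales (simp_all add: inner_commute)
  have "x = 0" if "x \<bullet> a = 0" "x \<bullet> b = 0" for x
    using expand[of x] that by simp
  then show ?thesis
    by (auto simp: homoclinic_contacts_def Ws_eq Wu_eq curve_limit_set_line swap.curve_limit_set_line)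
qed

lemma global:
  assumes "local_saddle f"
  shows "global_saddle f \<and>
         card (components (UNIV - (Ws f \<union> Wu f))) = 4 \<and>
         (\<forall>C \<in> components (UNIV - (Ws f \<union> Wu f)). f ` C = C)"
proof (intro conjI)
  interpret swap: orthonormal_frame b a
    using norm_a norm_b ab by unfold_locales (simp_all add: inner_commute)
  have "C1_homeomorphism f"
    unfolding C1_homeomorphism_def C1_map_def using homeo_f deriv_f cont_f' by blast
  then show "global_saddle f"
    unfolding global_saddle_def using assms f_0 no_contacts escape_f
      curve_param_line swap.curve_param_line unbounded_line swap.unbounded_line
    by (auto simp: Ws_eq Wu_eq)
  have S: "UNIV - (Ws f \<union> Wu f) = {x. x \<bullet> a \<noteq> 0 \<and> x \<bullet> b \<noteq> 0}" by (auto simp: Ws_eq Wu_eq)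
  show "card (components (UNIV - (Ws f \<union> Wu f))) = 4"
    unfolding S components_sectors by (rule card_sectors)
  show "\<forall>C \<in> components (UNIV - (Ws f \<union> Wu f)). f ` C = C"
    unfolding S components_sectors using sector_invariant by blast
qed

end

section \<open>Eigenvalues and the derivative at the fixed point\<close>

lemma eigenvalue_cases:
  assumes frame: "orthonormal_frame a b" and L: "linear L" "L a = \<alpha> *\<^sub>R a" "L b = \<beta> *\<^sub>R b"
    and l: "is_eigenvalue L l"
  shows "l = \<alpha> \<or> l = \<beta>"
proof -
  interpret orthonormal_frame a b by (rule frame)
  obtain v where v: "v \<noteq> 0" "L v = l *\<^sub>R v" using l by (auto simp: is_eigenvalue_def)
  have "L v = (\<alpha> * (v \<bullet> a)) *\<^sub>R a + (\<beta> * (v \<bullet> b)) *\<^sub>R b"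
    by (subst expand[of v, symmetric])
      (simp add: linear_add[OF L(1)] linear_cmul[OF L(1)] L(2,3) mult.commute)
  then have "l * (v \<bullet> a) = \<alpha> * (v \<bullet> a)" "l * (v \<bullet> b) = \<beta> * (v \<bullet> b)"
    using v(2) by (metis inner_add_left inner_scaleR_left inner_frame mult.right_neutral mult_zero_right add.right_neutral add.left_neutral)+
  moreover have "v \<bullet> a \<noteq> 0 \<or> v \<bullet> b \<noteq> 0" using expand[of v] v(1) by auto
  ultimately show ?thesis by auto
qed

text \<open>Differentiating \<open>f \<circ> s = s \<circ> f\<close> at 0 shows that
  \<open>L\<close> commutes with the reflection \<open>s\<close>, so \<open>L a\<close> is fixed by
  \<open>s\<close> and lies on the line of \<open>a\<close>.\<close>

lemma derivative_reflection:
  fixes a :: "real^2"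
  assumes a: "norm a = 1" and f: "(f has_derivative L) (at 0)" "f 0 = 0"
    and reflect: "\<And>x. f ((2 * (a \<bullet> x)) *\<^sub>R a - x) = (2 * (a \<bullet> f x)) *\<^sub>R a - f x"
  shows "L a = (a \<bullet> L a) *\<^sub>R a"
proof -
  define s where "s x = (2 * (a \<bullet> x)) *\<^sub>R a - x" for x
  have s: "bounded_linear s"
    unfolding s_def
    by (intro bounded_linear_sub bounded_linear_ident bounded_linear_scaleR_left[THEN bounded_linear_compose]
        bounded_linear_const_mult bounded_linear_inner_right)
  then have ds: "(s has_derivative s) (at x)" for x by (rule bounded_linear_imp_has_derivative)
  have "s 0 = 0" by (simp add: s_def)
  then have "(f \<circ> s has_derivative L \<circ> s) (at 0)" using f(1) ds[of 0] by (intro diff_chain_at) simp_all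
  moreover have "(s \<circ> f has_derivative s \<circ> L) (at 0)" using f(1) ds by (intro diff_chain_at) simp_all
  moreover have "f \<circ> s = s \<circ> f" using reflect by (simp add: s_def fun_eq_iff)
  ultimately have "L \<circ> s = s \<circ> L" using has_derivative_unique by metis
  moreover have "a \<bullet> a = 1" using a by (simp add: dot_square_norm)
  then have "s a = a" by (simp add: s_def flip: scaleR_2 scaleR_diff_left) (simp add: scaleR_2)
  ultimately have "L a = s (L a)" by (metis comp_apply)
  then have "2 *\<^sub>R L a = 2 *\<^sub>R ((a \<bullet> L a) *\<^sub>R a)" by (simp add: s_def scaleR_2 algebra_simps)
  then show ?thesis unfolding scaleR_cancel_left by simp
qed

lemma symmetry_line_reflection:
  assumes sym: "line_reflection u \<in> symmetry_group f" and u: "u \<noteq> 0"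
  shows "f ((2 * (sgn u \<bullet> x)) *\<^sub>R sgn u - x) = (2 * (sgn u \<bullet> f x)) *\<^sub>R sgn u - f x"
proof -
  let ?s = "\<lambda>x. (2 * (u \<bullet> x) / (u \<bullet> u)) *\<^sub>R u - x"
  have "linear ?s" by (rule linearI) (simp_all add: inner_add_right add_divide_distrib algebra_simps)
  then have "line_reflection u *v x = ?s x" for x
    unfolding line_reflection_def by (intro matrix_works) (simp only: linear_matrix_vector_mul_eq)
  then have "f (?s x) = ?s (f x)" using sym by (simp add: symmetry_group_def)
  moreover have "?s x = (2 * (sgn u \<bullet> x)) *\<^sub>R sgn u - x" for x
    by (simp add: sgn_div_norm dot_square_norm power2_eq_square divide_inverse)
  ultimately show ?thesis by simp
qed

theorem theorem4p3:
  fixes f :: "real^2 \<Rightarrow> real^2"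
  assumes "C1_homeomorphism f"
    and "orientation_preserving f"
    and "is_D2 (symmetry_group f)"
    and "Fix f = {0}"
    and "local_direct_saddle f"
  shows "global_saddle f \<and>
         card (components (UNIV - (Ws f \<union> Wu f))) = 4 \<and>
         (\<forall>C \<in> components (UNIV - (Ws f \<union> Wu f)). f ` C = C)"
proof -
  obtain u v where uv: "u \<noteq> 0" "v \<noteq> 0" "u \<bullet> v = 0"
      "symmetry_group f = generate GL2 {line_reflection u, line_reflection v}"
    using assms(3) unfolding is_D2_def by blast
  define a b where "a = sgn u" and "b = sgn v"
  have frame: "orthonormal_frame a b" "orthonormal_frame b a"
    using uv(1-3) by (simp_all add: orthonormal_frame_def a_def b_def norm_sgn sgn_div_norm inner_commute)
  have ra: "f ((2 * (a \<bullet> x)) *\<^sub>R a - x) = (2 * (a \<bullet> f x)) *\<^sub>R a - f x" for x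
    unfolding a_def using uv by (intro symmetry_line_reflection) (auto intro: generate.incl)
  have rb: "f ((2 * (b \<bullet> x)) *\<^sub>R b - x) = (2 * (b \<bullet> f x)) *\<^sub>R b - f x" for x
    unfolding b_def using uv by (intro symmetry_line_reflection) (auto intro: generate.incl)
  obtain f' :: "real^2 \<Rightarrow> (real^2) \<Rightarrow>\<^sub>L (real^2)"
    where f': "\<And>x. (f has_derivative blinfun_apply (f' x)) (at x)" "continuous_on UNIV f'"
    using assms(1) unfolding C1_homeomorphism_def C1_map_def by blast
  have "f 0 = 0" using assms(4) by (auto simp: Fix_def)
  define \<alpha> \<beta> where "\<alpha> = a \<bullet> f' 0 a" and "\<beta> = b \<bullet> f' 0 b"
  have eig: "f' 0 a = \<alpha> *\<^sub>R a" "f' 0 b = \<beta> *\<^sub>R b"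
    unfolding \<alpha>_def \<beta>_def
    using frame derivative_reflection[OF _ f'(1)[of 0] \<open>f 0 = 0\<close>] ra rb by (auto simp: orthonormal_frame_def)
  have "frechet_derivative f (at 0) = f' 0" using f'(1)[of 0] by (rule frechet_derivative_at[symmetric])
  then obtain l m where lm: "is_eigenvalue (f' 0) l" "is_eigenvalue (f' 0) m" "0 < l" "l < 1" "1 < m"
    using assms(5) unfolding local_direct_saddle_def by auto
  have saddle: "local_saddle f"
    using assms(5) unfolding local_direct_saddle_def local_saddle_def by blast
  have "linear (f' 0)" by (simp add: blinfun.bounded_linear_right bounded_linear.linear)
  then have "l = \<alpha> \<or> l = \<beta>" "m = \<alpha> \<or> m = \<beta>"
    using eigenvalue_cases[OF frame(1) _ eig] lm by auto
  \<comment> \<open>Since \<open>l < 1 < m\<close>, the two eigenvalues cannot be the same diagonal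
    entry. The cases decide which reflection axis contracts, and the frame is ordered
    accordingly.\<close>
  then consider "l = \<alpha>" "m = \<beta>" | "l = \<beta>" "m = \<alpha>" using lm by fastforce
  then show ?thesis
  proof cases
    case 1
    interpret D2_saddle a b f f' l m
      using frame(1) f' ra rb eig lm 1 assms(1,4)
      unfolding D2_saddle_def D2_saddle_axioms_def C1_homeomorphism_def Fix_def by auto
    show ?thesis by (rule global[OF saddle])
  next
    case 2
    interpret D2_saddle b a f f' l m
      using frame(2) f' ra rb eig lm 2 assms(1,4)
      unfolding D2_saddle_def D2_saddle_axioms_def C1_homeomorphism_def Fix_def by auto
    show ?thesis by (rule global[OF saddle])
  qed
qed

end
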